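(* Let $F=\{\mathbf{p}_0,\ldots,\mathbf{p}_n\}\subset\mathbb{R}^d$ be not contained in any $(d-1)$-dimensional affine subspace and consider the homogeneous IFS $S_i(\mathbf{x})=\lambda\mathbf{x}+(1-\lambda)\mathbf{p}_i$, $i=0,\ldots,n$, with $\lambda\in(2^{-1/(2d)},1)$ and $\lambda^{-2d}$ not a Pisot number. If every $\mathbf{x}\in\mathrm{int}(X)$ lies in $\mathrm{int}(\mathrm{conv}(B))$ for some $B\subseteq F$ consisting of $d+1$ points not contained in any $(d-1)$-dimensional affine subspace, then $\mathrm{int}(X)=X_{uni}$.
   Context: $\mathcal{D}=\{0,\ldots,n\}$. $X$ is the unique non-empty compact set with $X=\bigcup_{i\in\mathcal{D}}S_i(X)$, $\mathrm{int}$ denotes interior in $\mathbb{R}^d$ and $\mathrm{conv}$ convex hull. The coding map is $\pi(\mathbf{a})=\lim_{j\to\infty}(S_{a_1}\circ\cdots\circ S_{a_j})(\mathbf{0})$. A sequence in $\mathcal{D}^{\mathbb{N}}$ is universal if it contains every finite word over $\mathcal{D}$ as a block of consecutive digits; $X_{uni}$ is the set of $\mathbf{x}\in X$ with a universal $\mathbf{a}$ satisfying $\pi(\mathbf{a})=\mathbf{x}$. A Pisot number is a real algebraic integer $>1$ all of whose Galois conjugates have modulus strictly less than $1$. *)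

theory Defs
  imports "HOL-Analysis.Analysis" "HOL-Computational_Algebra.Polynomial"
begin

fun seq_comp :: "(nat \<Rightarrow> 'a \<Rightarrow> 'a) \<Rightarrow> (nat \<Rightarrow> nat) \<Rightarrow> nat \<Rightarrow> 'a \<Rightarrow> 'a" where
  "seq_comp S a 0 = id"
| "seq_comp S a (Suc j) = seq_comp S a j \<circ> S (a j)"

definition coding :: "(nat \<Rightarrow> 'a::real_normed_vector \<Rightarrow> 'a) \<Rightarrow> (nat \<Rightarrow> nat) \<Rightarrow> 'a" where
  "coding S a = lim (\<lambda>j. seq_comp S a j 0)"

definition universal :: "nat set \<Rightarrow> (nat \<Rightarrow> nat) \<Rightarrow> bool" where
  "universal D a \<longleftrightarrow> (\<forall>w \<in> lists D. \<exists>k. \<forall>m < length w. a (k + m) = w ! m)"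

definition X_uni :: "nat set \<Rightarrow> (nat \<Rightarrow> 'a::real_normed_vector \<Rightarrow> 'a) \<Rightarrow> 'a set \<Rightarrow> 'a set" where
  "X_uni D S X = {x \<in> X. \<exists>a. (\<forall>k. a k \<in> D) \<and> universal D a \<and> coding S a = x}"

definition pisot :: "real \<Rightarrow> bool" where
  "pisot x \<longleftrightarrow> x > 1 \<and>
     (\<exists>p :: int poly. lead_coeff p = 1 \<and> irreducible p \<and>
        poly (map_poly of_int p) (complex_of_real x) = 0 \<and>
        (\<forall>z. poly (map_poly of_int p) z = 0 \<and> z \<noteq> complex_of_real x \<longrightarrow> cmod z < 1))"

end

theory Submission
  imports Defs "HOL-Computational_Algebra.Polynomial_Factorial"
begin

text \<open>
  Put \<open>q = \<lambda>\<^sup>-\<^sup>2\<^sup>d \<in> (1,2)\<close> and let \<open>A\<close> be the set of finite sums of distinct powers of \<open>q\<close>.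

  If \<open>q\<close> is not Pisot, then \<open>A - A\<close> accumulates at \<open>0\<close>. Otherwise \<open>A\<close> is uniformly discrete, and
  comparing it with a window containing the largest possible number of points shows that the
  differences in \<open>[0,1]\<close> form a finite set. So \<open>q\<close> is an algebraic integer with a conjugate
  \<open>z \<noteq> q\<close>, \<open>\<bar>z\<bar> \<ge> 1\<close>; let \<open>\<sigma>\<close> be the embedding \<open>q \<mapsto> z\<close>. At large scales \<open>A\<close> looks, up to a set of
  small measure, the same when seen from any of its points, hence for a difference \<open>v < 1/(q(q-1))\<close>
  the step function \<open>\<sigma>(\<lfloor>y\<rfloor>\<^sub>A)\<close> is almost everywhere shifted by a constant under both
  translations \<open>q\<^sup>n v\<close> and \<open>q\<^sup>n\<^sup>-\<^sup>1\<close>. Integrating it in two ways gives \<open>z \<sigma>(v) = q v\<close>. Applied to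
  the differences \<open>q\<^sup>j - q\<^sup>j\<^sup>-\<^sup>1 - \<dots> - 1\<close> this forces \<open>q\<^sup>j\<^sup>+\<^sup>1 = q\<^sup>j + \<dots> + 1\<close>, whose other roots
  lie inside the unit disc.

  Hence finitely many low powers of \<open>q\<close> have subsums forming a fine chain, and together with a
  second copy of the powers, scaled by \<open>\<lambda>\<^sup>-\<^sup>1\<close>, they approximate every large number. In barycentric
  coordinates of a simplex \<open>B\<close> the digit positions are distributed modulo \<open>2d\<close>, two residue classes
  for each coordinate, so that from every interior point a digit string leads into any prescribed
  open set; in particular every block can be inserted next.\<close>

section \<open>Sums of distinct powers\<close>

text \<open>Horner's rule for sums of \<open>b i * q ^ i\<close>, \<open>i < n\<close>, with digits
  0 and 1: each recursion step appends a new lowest digit.\<close>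

primrec digit_sums :: "real \<Rightarrow> nat \<Rightarrow> real set" where
  "digit_sums q 0 = {0}"
| "digit_sums q (Suc n) = (\<lambda>a. q * a) ` digit_sums q n \<union> (\<lambda>a. q * a + 1) ` digit_sums q n"

lemma digit_sums_SucI: "a \<in> digit_sums q n \<Longrightarrow> e \<in> {0, 1} \<Longrightarrow> q * a + e \<in> digit_sums q (Suc n)"
  by auto

lemma digit_sums_SucE:
  assumes "a \<in> digit_sums q (Suc n)"
  obtains b e where "b \<in> digit_sums q n" "e \<in> {0, 1}" "a = q * b + e"
proof -
  from assms consider b where "b \<in> digit_sums q n" "a = q * b" | b where "b \<in> digit_sums q n" "a = q * b + 1"
    by auto
  then show ?thesis
    by cases (use that[of _ 0] that[of _ 1] in auto)
qed

lemma zero_in_digit_sums: "0 \<in> digit_sums q n"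
proof (induction n)
  case (Suc n)
  then show ?case using digit_sums_SucI[of 0 q n 0] by simp
qed simp

lemma one_in_digit_sums: "1 \<in> digit_sums q (Suc n)"
  using digit_sums_SucI[OF zero_in_digit_sums, of 1 q n] by simp

lemma finite_digit_sums: "finite (digit_sums q n)"
  by (induction n) auto

lemma digit_sums_append: "x \<in> digit_sums q k \<Longrightarrow> a \<in> digit_sums q n \<Longrightarrow> q ^ n * x + a \<in> digit_sums q (n + k)"
proof (induction n arbitrary: a)
  case (Suc n)
  obtain b e where b: "b \<in> digit_sums q n" "e \<in> {0, 1}" "a = q * b + e"
    using digit_sums_SucE[OF Suc.prems(2)] by blast
  have "q * (q ^ n * x + b) + e \<in> digit_sums q (Suc (n + k))"
    by (intro digit_sums_SucI Suc.IH Suc.prems b)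
  then show ?case
    by (simp add: b algebra_simps)
qed simp

lemma digit_sums_mono: "m \<le> n \<Longrightarrow> digit_sums q m \<subseteq> digit_sums q n"
  using digit_sums_append[OF zero_in_digit_sums, of _ q m "n - m"] by auto

lemma digit_sums_bits:
  assumes "a \<in> digit_sums q n"
  obtains b :: "nat \<Rightarrow> real" where "\<And>i. b i \<in> {0, 1}" "a = (\<Sum>i<n. b i * q ^ i)"
proof -
  have "\<exists>b :: nat \<Rightarrow> real. (\<forall>i. b i \<in> {0, 1}) \<and> a = (\<Sum>i<n. b i * q ^ i)"
    using assms
  proof (induction n arbitrary: a)
    case 0
    then show ?case by (intro exI[of _ "\<lambda>_. 0"]) auto
  next
    case (Suc n)
    obtain a' e where a': "a' \<in> digit_sums q n" "e \<in> {0, 1}" "a = q * a' + e"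
      using digit_sums_SucE[OF Suc.prems] by blast
    obtain b :: "nat \<Rightarrow> real" where b: "\<forall>i. b i \<in> {0, 1}" "a' = (\<Sum>i<n. b i * q ^ i)"
      using Suc.IH[OF a'(1)] by blast
    have "(\<Sum>i<Suc n. case_nat e b i * q ^ i) = e + (\<Sum>i<n. b i * q ^ Suc i)"
      by (subst sum.lessThan_Suc_shift) simp
    also have "\<dots> = a"
      by (simp add: a' b sum_distrib_left algebra_simps)
    finally show ?case
      using a' b by (intro exI[of _ "case_nat e b"]) (auto split: nat.split)
  qed
  then show ?thesis using that by blast
qed

section \<open>Greedy approximation for bases between 1 and 2\<close>

context
  fixes q :: real
  assumes q: "1 < q" "q < 2"
begin

lemma digit_sums_bounds:
  assumes "a \<in> digit_sums q n"
  shows "0 \<le> a" "a \<le> (q ^ n - 1) / (q - 1)"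
proof -
  have "0 \<le> a \<and> a \<le> (q ^ n - 1) / (q - 1)"
    using assms
  proof (induction n arbitrary: a)
    case (Suc n)
    obtain b e where b: "b \<in> digit_sums q n" "e \<in> {0, 1}" "a = q * b + e"
      using digit_sums_SucE[OF Suc.prems] by blast
    have "q * b \<le> q * ((q ^ n - 1) / (q - 1))"
      using Suc.IH[OF b(1)] q by (intro mult_left_mono) auto
    moreover have "q * ((q ^ n - 1) / (q - 1)) + 1 = (q ^ Suc n - 1) / (q - 1)"
      using q by (simp add: field_simps)
    ultimately show ?case
      using b Suc.IH[OF b(1)] q by auto
  qed simp
  then show "0 \<le> a" "a \<le> (q ^ n - 1) / (q - 1)" by auto
qed

lemma max_in_digit_sums: "(q ^ n - 1) / (q - 1) \<in> digit_sums q n"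
proof (induction n)
  case (Suc n)
  have "q * ((q ^ n - 1) / (q - 1)) + 1 = (q ^ Suc n - 1) / (q - 1)"
    using q by (simp add: field_simps)
  then show ?case
    using digit_sums_SucI[OF Suc, of 1] by simp
qed simp

text \<open>Greedy expansion: if \<open>y / q\<close> lies in \<open>[a, a + 1)\<close>, then
  \<open>y\<close> lies in \<open>[q * a, q * a + q)\<close>, and since \<open>q < 2\<close> the
  unit intervals starting at \<open>q * a\<close> and \<open>q * a + 1\<close> cover this.\<close>

lemma digit_sums_floor:
  assumes "0 \<le> y" "y < (q ^ n - 1) / (q - 1) + 1"
  shows "\<exists>a\<in>digit_sums q n. a \<le> y \<and> y < a + 1"
  using assms
proof (induction n arbitrary: y)
  case (Suc n)
  let ?M = "\<lambda>n. (q ^ n - 1) / (q - 1)"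
  have M: "?M (Suc n) = q * ?M n + 1"
    using q by (simp add: field_simps)
  show ?case
  proof (cases "y < q * (?M n + 1)")
    case True
    then have "\<exists>a\<in>digit_sums q n. a \<le> y / q \<and> y / q < a + 1"
      using q Suc.prems by (intro Suc.IH) (auto simp: field_simps)
    then obtain a where a: "a \<in> digit_sums q n" "q * a \<le> y" "y < q * a + q"
      using q by (auto simp: field_simps)
    show ?thesis
    proof (cases "y < q * a + 1")
      case True
      then show ?thesis using a digit_sums_SucI[OF a(1), of 0] by auto
    next
      case False
      then have "q * a + 1 \<le> y" "y < q * a + 1 + 1" using a q by linarith+
      then show ?thesis using digit_sums_SucI[OF a(1), of 1] by blast
    qed
  next
    case False
    \<comment> \<open>Beyond the reach of the induction hypothesis the largest digit sum is within 1
      of \<open>y\<close>.\<close>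
    then have "?M (Suc n) \<le> y"
      using M q by (simp add: distrib_left)
    then show ?thesis
      using Suc.prems max_in_digit_sums[of "Suc n"] by blast
  qed
qed simp

lemma digit_sums_ceil:
  assumes "0 \<le> y" "y \<le> (q ^ n - 1) / (q - 1)"
  shows "\<exists>a\<in>digit_sums q n. y \<le> a \<and> a \<le> y + 1"
proof (cases "y = (q ^ n - 1) / (q - 1)")
  case True
  then show ?thesis using max_in_digit_sums[of n] by (intro bexI[of _ y]) auto
next
  case False
  then have "y + 1 < (q ^ n - 1) / (q - 1) + 1" using assms by simp
  then obtain a where "a \<in> digit_sums q n" "a \<le> y + 1" "y + 1 < a + 1"
    using assms digit_sums_floor[of "y + 1" n] by auto
  then show ?thesis by (intro bexI[of _ a]) auto
qed

text \<open>A stretch on which digit sums are \<open>e\<close>-dense is prolonged by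
  \<open>e / q\<close>: a tiny difference \<open>x - y\<close>, scaled by a power of
  \<open>q\<close>, becomes a shift \<open>z\<close> between \<open>e / q\<close> and
  \<open>e\<close>, and the scaled \<open>x\<close> and \<open>y\<close> occupy digits above the
  \<open>n\<close> already used.\<close>

lemma digit_sums_eps_interval:
  assumes small: "\<And>e. e > 0 \<Longrightarrow> \<exists>k. \<exists>x\<in>digit_sums q k. \<exists>y\<in>digit_sums q k. 0 < x - y \<and> x - y < e"
    and "e > 0"
  shows "\<exists>n s. 0 \<le> s \<and> (\<forall>y. s \<le> y \<and> y \<le> s + real j * (e / q) \<longrightarrow> (\<exists>a\<in>digit_sums q n. \<bar>y - a\<bar> \<le> e))"
proof (induction j)
  case 0
  show ?case
    by (rule exI[of _ 0], rule exI[of _ 0]) (use \<open>e > 0\<close> in auto)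
next
  case (Suc j)
  let ?L = "real j * (e / q)"
  obtain n s where ns: "0 \<le> s" "\<And>y. s \<le> y \<Longrightarrow> y \<le> s + ?L \<Longrightarrow> \<exists>a\<in>digit_sums q n. \<bar>y - a\<bar> \<le> e"
    using Suc by blast
  have "e / q ^ n > 0" using \<open>e > 0\<close> q by simp
  then obtain k x y where xy: "x \<in> digit_sums q k" "y \<in> digit_sums q k" "0 < x - y" "x - y < e / q ^ n"
    using small by meson
  have "\<exists>m. q ^ m * (x - y) > e"
  proof -
    obtain m where "q ^ m > e / (x - y)" using real_arch_pow[OF q(1)] by blast
    then show ?thesis using xy by (auto simp: field_simps)
  qed
  then obtain m0 where m0: "q ^ m0 * (x - y) > e" "\<And>m. m < m0 \<Longrightarrow> q ^ m * (x - y) \<le> e"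
    using exists_least_iff[of "\<lambda>m. q ^ m * (x - y) > e"] by (auto simp: not_less)
  have "n < m0"
  proof (rule ccontr)
    assume "\<not> n < m0"
    then have "q ^ m0 * (x - y) \<le> q ^ n * (x - y)"
      using q xy by (intro mult_right_mono power_increasing) auto
    also have "\<dots> < e" using xy q by (simp add: field_simps)
    finally show False using m0 by simp
  qed
  define m where "m = m0 - 1"
  have m: "m0 = Suc m" "n \<le> m" using \<open>n < m0\<close> by (auto simp: m_def)
  define z where "z = q ^ m * (x - y)"
  have z: "z \<le> e" "e / q < z" using m0(1) m0(2)[of m] m q by (auto simp: z_def field_simps)
  have low: "q ^ m * u + a \<in> digit_sums q (m + k)" if "u \<in> {x, y}" "a \<in> digit_sums q n" for u a
    using that xy digit_sums_mono[OF m(2), of q] digit_sums_append[of u q k a m] by auto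
  show ?case
  proof (intro exI conjI allI impI)
    show "0 \<le> s + q ^ m * y" using ns(1) digit_sums_bounds(1)[OF xy(2)] q by simp
    fix t assume t: "s + q ^ m * y \<le> t \<and> t \<le> s + q ^ m * y + real (Suc j) * (e / q)"
    let ?t = "t - q ^ m * y"
    have t': "s \<le> ?t" "?t \<le> s + ?L + e / q" using t by (auto simp: distrib_right add_divide_distrib)
    have shift: "\<bar>t - (q ^ m * y + a)\<bar> = \<bar>?t - a\<bar>" "\<bar>t - (q ^ m * x + a)\<bar> = \<bar>?t - z - a\<bar>" for a
      by (simp_all add: z_def algebra_simps)
    consider "?t \<le> s + ?L" | "?t > s + ?L" "s \<le> ?t - z" | "?t > s + ?L" "?t - z < s" by linarith
    then show "\<exists>a\<in>digit_sums q (m + k). \<bar>t - a\<bar> \<le> e"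
    proof cases
      case 1
      then obtain a where "a \<in> digit_sums q n" "\<bar>?t - a\<bar> \<le> e" using ns(2)[of ?t] t' by blast
      then show ?thesis using low[of y a] shift(1)[of a] by (intro bexI[of _ "q ^ m * y + a"]) simp_all
    next
      case 2
      moreover have "?t - z \<le> s + ?L" using t' z by linarith
      ultimately obtain a where "a \<in> digit_sums q n" "\<bar>?t - z - a\<bar> \<le> e" using ns(2)[of "?t - z"] by blast
      then show ?thesis using low[of x a] shift(2)[of a] by (intro bexI[of _ "q ^ m * x + a"]) simp_all
    next
      \<comment> \<open>Occurs only for a stretch shorter than \<open>z\<close>: \<open>?t\<close>
        lies between the stretch and its shift, and the point approximating \<open>s\<close>, or its
        shift by \<open>z\<close>, is close enough.\<close>
      case 3
      have "?L \<ge> 0" using \<open>e > 0\<close> q by simp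
      then obtain a where a: "a \<in> digit_sums q n" "\<bar>s - a\<bar> \<le> e" using ns(2)[of s] by auto
      show ?thesis
      proof (cases "?t \<ge> a")
        case True
        have "\<bar>?t - a\<bar> \<le> e \<or> \<bar>?t - z - a\<bar> \<le> e"
          using True 3 a z t' by linarith
        then show ?thesis using low[of x a] low[of y a] shift[of a] a(1) by (metis insertI1 insertI2)
      next
        case False
        then have "\<bar>?t - a\<bar> \<le> e" using 3 a t' by linarith
        then show ?thesis using low[of y a] shift[of a] a(1) by (metis insertI1 insertI2)
      qed
    qed
  qed
qed

text \<open>The coarse part \<open>b * a'\<close> is chosen greedily and leaves a remainder in
  \<open>[s, s + b)\<close>, a bounded stretch on which the sums of the \<open>n0\<close> lowest
  powers are already \<open>e\<close>-dense.\<close>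

lemma two_scale_dense:
  assumes small: "\<And>e. e > 0 \<Longrightarrow> \<exists>k. \<exists>x\<in>digit_sums q k. \<exists>y\<in>digit_sums q k. 0 < x - y \<and> x - y < e"
    and "e > 0" "b > 0"
  shows "\<exists>s n0. \<forall>n\<ge>n0. \<forall>y. s \<le> y \<and> y \<le> b * ((q ^ n - 1) / (q - 1)) \<longrightarrow>
           (\<exists>a\<in>digit_sums q n. \<exists>a'\<in>digit_sums q n. \<bar>y - (a + b * a')\<bar> \<le> e)"
proof -
  obtain j where j: "real j > b / (e / q)" using reals_Archimedean2 by blast
  then have j: "b \<le> real j * (e / q)" using \<open>e > 0\<close> q by (simp add: field_simps)
  obtain n0 s where ns: "0 \<le> s"
    "\<And>y. s \<le> y \<Longrightarrow> y \<le> s + real j * (e / q) \<Longrightarrow> \<exists>a\<in>digit_sums q n0. \<bar>y - a\<bar> \<le> e"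
    using digit_sums_eps_interval[OF small \<open>e > 0\<close>, of j] by blast
  show ?thesis
  proof (rule exI[of _ s], rule exI[of _ n0], intro allI impI)
    fix n y assume n: "n0 \<le> n" and y: "s \<le> y \<and> y \<le> b * ((q ^ n - 1) / (q - 1))"
    have "(y - s) / b < (q ^ n - 1) / (q - 1) + 1"
    proof -
      have "(y - s) / b \<le> (q ^ n - 1) / (q - 1)"
        using y ns(1) \<open>b > 0\<close> by (simp add: pos_divide_le_eq mult.commute)
      then show ?thesis by simp
    qed
    then obtain a' where a': "a' \<in> digit_sums q n" "a' \<le> (y - s) / b" "(y - s) / b < a' + 1"
      using digit_sums_floor[of "(y - s) / b" n] y \<open>b > 0\<close> by auto
    then have "s \<le> y - b * a'" "y - b * a' \<le> s + real j * (e / q)"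
      using \<open>b > 0\<close> j by (auto simp: field_simps)
    then obtain a where a: "a \<in> digit_sums q n0" "\<bar>y - b * a' - a\<bar> \<le> e" using ns(2) by blast
    then show "\<exists>a\<in>digit_sums q n. \<exists>a'\<in>digit_sums q n. \<bar>y - (a + b * a')\<bar> \<le> e"
      using a'(1) digit_sums_mono[OF n, of q] by (intro bexI[of _ a] bexI[of _ a']) (auto simp: algebra_simps)
  qed
qed

end

section \<open>Uniformly discrete digit sums\<close>

locale separated_digit_sums =
  fixes q \<delta> :: real
  assumes q: "1 < q" "q < 2"
    and \<delta>: "0 < \<delta>"
    and sep: "x \<in> digit_sums q k \<Longrightarrow> y \<in> digit_sums q k \<Longrightarrow> x \<noteq> y \<Longrightarrow> \<delta> \<le> \<bar>x - y\<bar>"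
begin

definition A :: "real set" where "A = (\<Union>n. digit_sums q n)"

text \<open>The sum of \<open>1 / q ^ i\<close> over \<open>i \<ge> 1\<close>: digit sums of length
  \<open>n\<close>, divided by \<open>q ^ n\<close>, lie in \<open>[0, c)\<close> and come
  arbitrarily close to \<open>c\<close>.\<close>

definition c :: real where "c = 1 / (q - 1)"

lemma c_gt_1: "1 < c"
  using q by (simp add: c_def field_simps)

lemma q_times_c: "q * c = c + 1"
  using q by (simp add: c_def field_simps)

lemma digit_sums_subset_A: "digit_sums q n \<subseteq> A"
  by (auto simp: A_def)

lemma zero_in_A: "0 \<in> A" and one_in_A: "1 \<in> A"
  using zero_in_digit_sums[of q 0] one_in_digit_sums[of q 0] digit_sums_subset_A by blast+

lemma A_common:
  assumes "x \<in> A" "y \<in> A"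
  obtains k where "x \<in> digit_sums q k" "y \<in> digit_sums q k"
proof -
  obtain i j where ij: "x \<in> digit_sums q i" "y \<in> digit_sums q j"
    using assms by (auto simp: A_def)
  show ?thesis
    using ij digit_sums_mono[of i "max i j" q] digit_sums_mono[of j "max i j" q]
    by (intro that[of "max i j"]) auto
qed

lemma sep_A: "x \<in> A \<Longrightarrow> y \<in> A \<Longrightarrow> x \<noteq> y \<Longrightarrow> \<delta> \<le> \<bar>x - y\<bar>"
  by (metis A_common sep)

lemma A_nonneg: "x \<in> A \<Longrightarrow> 0 \<le> x"
  using digit_sums_bounds(1)[OF q] by (auto simp: A_def)

lemma A_append: "x \<in> A \<Longrightarrow> a \<in> digit_sums q n \<Longrightarrow> q ^ n * x + a \<in> A"
  using digit_sums_append[of x q _ a n] by (auto simp: A_def)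

lemma A_digit: "x \<in> A \<Longrightarrow> e \<in> {0, 1} \<Longrightarrow> q * x + e \<in> A"
  using A_append[of x e 1] by auto

lemma A_step:
  assumes "x \<in> A"
  obtains y e where "y \<in> A" "e \<in> {0, 1}" "x = q * y + e"
proof -
  obtain n where "x \<in> digit_sums q n" using assms by (auto simp: A_def)
  then have "x \<in> digit_sums q (Suc n)" using digit_sums_mono[of n "Suc n" q] by auto
  then show ?thesis
    using that digit_sums_subset_A by (elim digit_sums_SucE) blast
qed

lemma countable_A: "countable A"
  by (auto simp: A_def intro: countable_finite finite_digit_sums)

lemma power_max_large: "\<exists>m0. \<forall>m\<ge>m0. C * q ^ m + t \<le> (q ^ m - 1) / (q - 1)" if "C < c"
proof -
  obtain m0 where "(t + c) / (c - C) < q ^ m0" using real_arch_pow[OF q(1)] by blast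
  then have "(t + c) / (c - C) \<le> q ^ m" if "m \<ge> m0" for m
    using power_increasing[OF that, of q] q by linarith
  then have "t + c \<le> q ^ m * (c - C)" if "m \<ge> m0" for m
    using that \<open>C < c\<close> by (simp add: pos_divide_le_eq)
  then have "C * q ^ m + t \<le> q ^ m * c - c" if "m \<ge> m0" for m
    using that by (force simp: algebra_simps)
  moreover have "(q ^ m - 1) / (q - 1) = q ^ m * c - c" for m
    by (simp add: c_def diff_divide_distrib)
  ultimately show ?thesis by auto
qed

lemma A_floor:
  assumes "0 \<le> y"
  obtains a where "a \<in> A" "a \<le> y" "y < a + 1"
proof -
  obtain m where "y \<le> (q ^ m - 1) / (q - 1)"
    using power_max_large[of 0 y] c_gt_1 by force
  then show ?thesis
    using digit_sums_floor[OF q assms, of m] that digit_sums_subset_A by force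
qed

lemma A_window:
  shows finite_A_window: "finite (A \<inter> {t..t + L})"
    and card_A_window: "card (A \<inter> {t..t + L}) \<le> nat \<lfloor>L / \<delta>\<rfloor> + 1"
proof -
  let ?f = "\<lambda>x. nat \<lfloor>(x - t) / \<delta>\<rfloor>"
  have inj: "inj_on ?f (A \<inter> {t..t + L})"
  proof (rule inj_onI, rule ccontr)
    fix x y assume xy: "x \<in> A \<inter> {t..t + L}" "y \<in> A \<inter> {t..t + L}" "?f x = ?f y" "x \<noteq> y"
    have "\<lfloor>(x - t) / \<delta>\<rfloor> = \<lfloor>(y - t) / \<delta>\<rfloor>"
      using xy \<delta> by (simp add: nat_eq_iff split: if_splits)
    then have "\<bar>(x - t) / \<delta> - (y - t) / \<delta>\<bar> < 1" by linarith
    moreover have "(x - t) / \<delta> - (y - t) / \<delta> = (x - y) / \<delta>"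
      by (simp add: diff_divide_distrib)
    ultimately have "\<bar>x - y\<bar> < \<delta>" using \<delta> by (simp add: abs_divide)
    then show False using sep_A[of x y] xy by auto
  qed
  have sub: "?f ` (A \<inter> {t..t + L}) \<subseteq> {..nat \<lfloor>L / \<delta>\<rfloor>}"
    using \<delta> by (auto intro!: nat_mono floor_mono divide_right_mono)
  show fin: "finite (A \<inter> {t..t + L})"
    using finite_imageD[OF finite_subset[OF sub] inj] by simp
  show "card (A \<inter> {t..t + L}) \<le> nat \<lfloor>L / \<delta>\<rfloor> + 1"
    using card_inj_on_le[OF inj sub] by simp
qed

text \<open>A window containing the largest possible number of points of \<open>A\<close> is reproduced by
  every \<open>x \<in> A\<close> at scale \<open>q\<^sup>m\<close>, and by maximality nothing else falls into the copy.\<close>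

lemma saturated_window:
  obtains n0 t where "0 \<le> t"
    "\<And>m x a. n0 \<le> m \<Longrightarrow> x \<in> A \<Longrightarrow> a \<in> A \<Longrightarrow> t \<le> a - q ^ m * x \<Longrightarrow> a - q ^ m * x \<le> t + L \<Longrightarrow>
       a - q ^ m * x \<in> digit_sums q m"
proof -
  let ?N = "\<lambda>t. card (A \<inter> {t..t + L})"
  have "?N ` {0..} \<subseteq> {..nat \<lfloor>L / \<delta>\<rfloor> + 1}"
    using card_A_window by auto
  then have fin: "finite (?N ` {0..})" using finite_subset by blast
  moreover have "?N ` {0..} \<noteq> {}" by auto
  ultimately have "Max (?N ` {0..}) \<in> ?N ` {0..}" by (rule Max_in)
  then obtain t where t: "0 \<le> t" "?N t = Max (?N ` {0..})" by auto
  have max: "?N u \<le> ?N t" if "0 \<le> u" for u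
    unfolding t(2) using fin that by (intro Max_ge) auto
  let ?W = "A \<inter> {t..t + L}"
  have "\<forall>w\<in>?W. \<exists>n. w \<in> digit_sums q n" by (auto simp: A_def)
  then obtain f where f: "\<And>w. w \<in> ?W \<Longrightarrow> w \<in> digit_sums q (f w)" by metis
  have "w \<in> digit_sums q (sum f ?W)" if "w \<in> ?W" for w
    using f[OF that] digit_sums_mono[OF member_le_sum[OF that _ finite_A_window], of f q] by auto
  then obtain n0 where n0: "?W \<subseteq> digit_sums q n0" by blast
  show ?thesis
  proof (rule that[of t n0])
    fix m x a assume *: "n0 \<le> m" "x \<in> A" "a \<in> A" "t \<le> a - q ^ m * x" "a - q ^ m * x \<le> t + L"
    have Wm: "?W \<subseteq> digit_sums q m" using n0 digit_sums_mono[OF *(1), of q] by auto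
    let ?V = "A \<inter> {q ^ m * x + t..q ^ m * x + t + L}"
    have sub: "(+) (q ^ m * x) ` ?W \<subseteq> ?V"
      using Wm A_append[OF *(2), of _ m] by auto
    have "0 \<le> q ^ m * x + t" using t(1) A_nonneg[OF *(2)] q by simp
    then have "card ?V \<le> card ?W" using max by blast
    also have "\<dots> = card ((+) (q ^ m * x) ` ?W)" by (simp add: card_image)
    finally have "(+) (q ^ m * x) ` ?W = ?V"
      using card_seteq[OF finite_A_window sub] by simp
    moreover have "a \<in> ?V" using * by auto
    ultimately obtain w where "w \<in> ?W" "a = q ^ m * x + w" by (metis imageE)
    then have "a - q ^ m * x \<in> ?W" by simp
    then show "a - q ^ m * x \<in> digit_sums q m" using Wm by blast
  qed (rule t)
qed

text \<open>Choose a digit sum \<open>a\<close> slightly above \<open>q ^ m * (x - y) + t\<close>.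
  Then \<open>q ^ m * y + a\<close>, seen from \<open>x\<close>, falls into the saturated window, so
  it equals \<open>q ^ m * x + g\<close> with \<open>g\<close> again of length \<open>m\<close>;
  there are only finitely many values \<open>(a - g) / q ^ m\<close>.\<close>

lemma finite_A_diff: "finite {x - y | x y. x \<in> A \<and> y \<in> A \<and> 0 \<le> x - y \<and> x - y \<le> 1}"
proof -
  obtain n0 t where t: "0 \<le> t"
    "\<And>m x a. n0 \<le> m \<Longrightarrow> x \<in> A \<Longrightarrow> a \<in> A \<Longrightarrow> t \<le> a - q ^ m * x \<Longrightarrow> a - q ^ m * x \<le> t + 1 \<Longrightarrow>
       a - q ^ m * x \<in> digit_sums q m"
    using saturated_window[of 1] by metis
  obtain m0 where m0: "\<And>m. m \<ge> m0 \<Longrightarrow> 1 * q ^ m + t \<le> (q ^ m - 1) / (q - 1)"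
    using power_max_large[OF c_gt_1, of t] by blast
  define m where "m = max n0 m0"
  have m: "n0 \<le> m" "q ^ m + t \<le> (q ^ m - 1) / (q - 1)"
    using m0[of m] by (auto simp: m_def)
  have "{x - y | x y. x \<in> A \<and> y \<in> A \<and> 0 \<le> x - y \<and> x - y \<le> 1}
    \<subseteq> (\<lambda>(a, g). (a - g) / q ^ m) ` (digit_sums q m \<times> digit_sums q m)"
  proof safe
    fix x y assume xy: "x \<in> A" "y \<in> A" "0 \<le> x - y" "x - y \<le> 1"
    let ?u = "q ^ m * (x - y) + t"
    have u: "0 \<le> ?u" using t(1) xy q by simp
    have "q ^ m * (x - y) \<le> q ^ m" using xy q by (simp add: mult_left_le)
    then have "?u \<le> (q ^ m - 1) / (q - 1)" using m(2) by linarith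
    then obtain a where a: "a \<in> digit_sums q m" "?u \<le> a" "a \<le> ?u + 1"
      using digit_sums_ceil[OF q u] by blast
    let ?g = "q ^ m * y + a - q ^ m * x"
    have "?g \<in> digit_sums q m"
      using a xy m by (intro t(2) A_append) (auto simp: algebra_simps)
    moreover have "x - y = (a - ?g) / q ^ m" using q by (simp add: field_simps)
    ultimately show "x - y \<in> (\<lambda>(a, g). (a - g) / q ^ m) ` (digit_sums q m \<times> digit_sums q m)"
      using a(1) by (intro image_eqI[of _ _ "(a, ?g)"]) auto
  qed
  then show ?thesis
    by (rule finite_subset) (simp add: finite_digit_sums)
qed

end

section \<open>Porous sets and the null set of bad positions\<close>

text \<open>Let \<open>w\<close> be the supremum of the density of \<open>E\<close> over
  subintervals. Cutting out the gap given by \<open>por\<close> bounds each density by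
  \<open>(1 - k) * w\<close>, so \<open>w \<le> (1 - k) * w\<close> and
  \<open>w \<le> 0\<close>.\<close>

lemma measure_porous_zero:
  fixes E :: "real set"
  assumes meas: "E \<in> sets borel" and k: "0 < k" and ab: "a < b"
    and por: "\<And>u l. 0 < l \<Longrightarrow> a \<le> u \<Longrightarrow> u + l \<le> b \<Longrightarrow>
                \<exists>v. u \<le> v \<and> v + k * l \<le> u + l \<and> E \<inter> {v..v + k * l} = {}"
  shows "measure lborel (E \<inter> {a..b}) = 0"
proof -
  let ?m = "\<lambda>u l. measure lborel (E \<inter> {u..u + l})"
  define D where "D = {(u, l). 0 < l \<and> a \<le> u \<and> u + l \<le> b}"
  define w where "w = (SUP (u, l)\<in>D. ?m u l / l)"
  have fm: "E \<inter> {u..v} \<in> fmeasurable lborel" for u v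
    using meas by (intro fmeasurableI2[OF fmeasurable_cbox[of u v, simplified]]) auto
  have le: "?m u l \<le> l" if "0 \<le> l" for u l
  proof -
    have "?m u l \<le> measure lborel {u..u + l}"
      using meas fmeasurable_cbox[of u "u + l"] by (intro measure_mono_fmeasurable) auto
    then show ?thesis using that by simp
  qed
  have bdd: "bdd_above ((\<lambda>(u, l). ?m u l / l) ` D)"
    by (intro bdd_aboveI[of _ 1]) (auto simp: D_def le)
  have up: "?m u l \<le> w * l" if "0 \<le> l" "a \<le> u" "u + l \<le> b" for u l
  proof (cases "l = 0")
    case False
    then have "?m u l / l \<le> w"
      unfolding w_def using that by (intro cSUP_upper2[OF bdd, of "(u, l)"]) (auto simp: D_def)
    then show ?thesis using False that by (simp add: divide_le_eq)
  qed (use le[of 0 u] in simp)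
  have "?m u l / l \<le> (1 - k) * w" if ul: "(u, l) \<in> D" for u l
  proof -
    have l: "0 < l" "a \<le> u" "u + l \<le> b" using ul by (auto simp: D_def)
    obtain v where v: "u \<le> v" "v + k * l \<le> u + l" "E \<inter> {v..v + k * l} = {}"
      using por[OF l] by blast
    have kl: "0 < k * l" using k l by simp
    let ?l1 = "v - u" and ?l2 = "u + l - (v + k * l)"
    have "E \<inter> {u..u + l} \<subseteq> E \<inter> {u..u + ?l1} \<union> E \<inter> {v + k * l..v + k * l + ?l2}"
      using v by auto
    then have "?m u l \<le> measure lborel (E \<inter> {u..u + ?l1} \<union> E \<inter> {v + k * l..v + k * l + ?l2})"
      using meas by (intro measure_mono_fmeasurable fmeasurable.Un fm) auto
    also have "\<dots> \<le> ?m u ?l1 + ?m (v + k * l) ?l2"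
      using meas by (intro measure_Un_le) auto
    also have "\<dots> \<le> w * ?l1 + w * ?l2"
      using v l kl by (intro add_mono up) auto
    also have "\<dots> = (1 - k) * w * l" by (simp add: algebra_simps)
    finally show ?thesis using l by (simp add: pos_divide_le_eq)
  qed
  moreover have "(a, b - a) \<in> D" using ab by (simp add: D_def)
  then have "D \<noteq> {}" by blast
  ultimately have "w \<le> (1 - k) * w"
    unfolding w_def[symmetric] by (subst w_def, intro cSUP_least) auto
  then have "w \<le> 0" using k by (simp add: algebra_simps mult_le_0_iff)
  then have "?m a (b - a) \<le> 0"
    using up[of "b - a" a] ab mult_nonpos_nonneg[of w "b - a"] by auto
  then show ?thesis by (simp add: measure_le_0_iff)
qed

context separated_digit_sums
begin

text \<open>Seen from \<open>x\<close> at scale \<open>q\<^sup>n\<close>, a position is bad if a nearby point of \<open>A\<close> does not descend from \<open>x\<close>.\<close>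

definition bad :: "real \<Rightarrow> nat \<Rightarrow> real set" where
  "bad x n = {y. \<exists>e\<in>A. e - q ^ n * x \<notin> digit_sums q n \<and> 0 \<le> q ^ n * (x + y) - e \<and> q ^ n * (x + y) - e \<le> c}"

text \<open>Dropping the last digit of a stray point \<open>e\<close> leaves a stray point
  \<open>f\<close> one level up. The tolerance \<open>c\<close> is preserved: an error of at most
  \<open>c\<close> plus a digit, divided by \<open>q\<close>, is at most
  \<open>(c + 1) / q = c\<close>.\<close>

lemma bad_decreasing: "bad x (Suc n) \<subseteq> bad x n"
proof
  fix y assume "y \<in> bad x (Suc n)"
  then obtain e where e: "e \<in> A" "e - q ^ Suc n * x \<notin> digit_sums q (Suc n)"
    "0 \<le> q ^ Suc n * (x + y) - e" "q ^ Suc n * (x + y) - e \<le> c" by (auto simp: bad_def)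
  obtain f d where f: "f \<in> A" "d \<in> {0, 1}" "e = q * f + d" using A_step[OF e(1)] by blast
  have "f - q ^ n * x \<notin> digit_sums q n"
    using digit_sums_SucI[of "f - q ^ n * x" q n d] f e(2) by (auto simp: algebra_simps)
  moreover have "q * (q ^ n * (x + y) - f) = q ^ Suc n * (x + y) - e + d"
    by (simp add: f algebra_simps)
  then have "0 \<le> q * (q ^ n * (x + y) - f)" "q * (q ^ n * (x + y) - f) \<le> q * c"
    using e f(2) by (auto simp: q_times_c)
  then have "0 \<le> q ^ n * (x + y) - f" "q ^ n * (x + y) - f \<le> c"
    using q by (auto simp: zero_le_mult_iff)
  ultimately show "y \<in> bad x n" using f(1) by (auto simp: bad_def)
qed

lemma bad_antimono: "n \<le> m \<Longrightarrow> bad x m \<subseteq> bad x n"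
  by (rule lift_Suc_antimono_le[of "bad x"]) (rule bad_decreasing)

lemma bad_measurable [measurable]: "bad x n \<in> sets borel"
proof -
  have "bad x n = (\<Union>e\<in>{e\<in>A. e - q ^ n * x \<notin> digit_sums q n}. {y. 0 \<le> q ^ n * (x + y) - e \<and> q ^ n * (x + y) - e \<le> c})"
    by (auto simp: bad_def)
  also have "\<dots> \<in> sets borel"
    by (intro sets.countable_UN' countable_subset[OF _ countable_A]) auto
  finally show ?thesis .
qed

text \<open>Take a digit sum \<open>b\<close> with \<open>b / q ^ N\<close> just right of
  \<open>u\<close>, at a scale comparable to \<open>l\<close>. The saturated window of
  \<open>q ^ N * x + b\<close> yields an interval of positions near which all points of
  \<open>A\<close> descend from \<open>x\<close>.\<close>

lemma bad_porous:
  assumes "x \<in> A"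
  obtains k where "0 < k"
    "\<And>u l. 0 < l \<Longrightarrow> 0 \<le> u \<Longrightarrow> u + l \<le> c \<Longrightarrow>
       \<exists>v. u \<le> v \<and> v + k * l \<le> u + l \<and> (\<Inter>n. bad x n) \<inter> {v..v + k * l} = {}"
proof -
  obtain m t where t: "0 \<le> t"
    "\<And>x a. x \<in> A \<Longrightarrow> a \<in> A \<Longrightarrow> t \<le> a - q ^ m * x \<Longrightarrow> a - q ^ m * x \<le> t + (c + 1) \<Longrightarrow>
       a - q ^ m * x \<in> digit_sums q m"
    using saturated_window[of "c + 1"] by (metis order_refl)
  \<comment> \<open>\<open>Q > c\<close> keeps \<open>b\<close> within reach of digit sums of length
    \<open>N\<close>; the last bound on \<open>Q\<close> makes the clean interval end before
    \<open>u + l\<close>.\<close>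
  define Q where "Q = c + 1 + (t + (c + 1)) / q ^ m"
  have Q: "Q > c" "Q > 0" "Q \<ge> 1 + (t + (c + 1)) / q ^ m" using c_gt_1 t q by (auto simp: Q_def intro: add_pos_nonneg)
  define k where "k = 1 / (q ^ Suc m * Q)"
  show ?thesis
  proof (rule that[of k])
    show "0 < k" using Q q by (simp add: k_def)
    fix u l :: real assume ul: "0 < l" "0 \<le> u" "u + l \<le> c"
    obtain n0 where "Q / l < q ^ n0" using real_arch_pow[OF q(1)] by blast
    then have "Q / q ^ n0 \<le> l" using ul q Q by (simp add: field_simps)
    then obtain n1 where n1: "Q / q ^ n1 \<le> l" "\<And>i. i < n1 \<Longrightarrow> \<not> Q / q ^ i \<le> l"
      using exists_least_iff[of "\<lambda>n. Q / q ^ n \<le> l"] by auto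
    have "n1 \<noteq> 0"
    proof
      assume "n1 = 0"
      then show False using n1(1) ul Q by simp
    qed
    then obtain n where n: "n1 = Suc n" by (cases n1) auto
    define N where "N = Suc n"
    have N: "Q / q ^ N \<le> l" "l < q * (Q / q ^ N)"
      using n1(1) n1(2)[of n] n q by (auto simp: N_def)
    have qN: "Q \<le> q ^ N * l" using N(1) q by (simp add: pos_divide_le_eq mult.commute)
    have "q ^ N * u \<le> q ^ N * c - q ^ N * l"
      using ul(3) q mult_left_mono[of u "c - l" "q ^ N"] by (simp add: right_diff_distrib)
    then have "q ^ N * u \<le> q ^ N * c - c" using qN Q by linarith
    then have "q ^ N * u \<le> (q ^ N - 1) / (q - 1)" by (simp add: c_def diff_divide_distrib)
    then obtain b where b: "b \<in> digit_sums q N" "q ^ N * u \<le> b" "b \<le> q ^ N * u + 1"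
      using digit_sums_ceil[OF q, of "q ^ N * u" N] ul q by auto
    \<comment> \<open>With the offset \<open>t + c\<close>, points of \<open>A\<close> at most
      \<open>c\<close> below the scaled position land in the window
      \<open>[t, t + (c + 1)]\<close>.\<close>
    define v where "v = b / q ^ N + (t + c) / q ^ (m + N)"
    have "k * l \<le> 1 / q ^ (m + N)"
      using N(2) Q q by (simp add: k_def field_simps power_add)
    moreover have "v + 1 / q ^ (m + N) \<le> u + l"
    proof -
      have "v + 1 / q ^ (m + N) = (b + (t + (c + 1)) / q ^ m) / q ^ N"
        by (simp add: v_def add_divide_distrib power_add)
      also have "\<dots> \<le> (q ^ N * u + Q) / q ^ N"
        using b Q q by (intro divide_right_mono) auto
      also have "\<dots> \<le> u + l" using N(1) q by (simp add: add_divide_distrib)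
      finally show ?thesis .
    qed
    moreover have "u \<le> v"
    proof -
      have "u \<le> b / q ^ N" using b q by (simp add: field_simps)
      moreover have "0 \<le> (t + c) / q ^ (m + N)" using t c_gt_1 q by simp
      ultimately show ?thesis by (simp add: v_def)
    qed
    moreover have "y \<notin> bad x (m + N)" if y: "v \<le> y" "y \<le> v + 1 / q ^ (m + N)" for y
    proof
      assume "y \<in> bad x (m + N)"
      then obtain e where e: "e \<in> A" "e - q ^ (m + N) * x \<notin> digit_sums q (m + N)"
        "0 \<le> q ^ (m + N) * (x + y) - e" "q ^ (m + N) * (x + y) - e \<le> c" by (auto simp: bad_def)
      have v: "q ^ (m + N) * v = q ^ m * b + (t + c)"
        using q by (simp add: v_def power_add field_simps)
      have "q ^ (m + N) * v \<le> q ^ (m + N) * y" "q ^ (m + N) * y \<le> q ^ (m + N) * (v + 1 / q ^ (m + N))"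
        using y q by (intro mult_left_mono; simp)+
      then have y': "q ^ m * b + (t + c) \<le> q ^ (m + N) * y" "q ^ (m + N) * y \<le> q ^ m * b + (t + c) + 1"
        using q v by (auto simp: distrib_left)
      have bx: "q ^ N * x + b \<in> A" by (rule A_append[OF \<open>x \<in> A\<close> b(1)])
      have eq: "e - q ^ m * (q ^ N * x + b) = e - q ^ (m + N) * x - q ^ m * b"
        by (simp add: power_add algebra_simps)
      have "e - q ^ m * (q ^ N * x + b) \<in> digit_sums q m"
        using e(3,4) y' by (intro t(2)[OF bx e(1)]; unfold eq; simp add: distrib_left)
      then have "q ^ m * b + (e - q ^ m * (q ^ N * x + b)) \<in> digit_sums q (m + N)"
        by (rule digit_sums_append[OF b(1)])
      then show False using e(2) eq by simp
    qed
    ultimately show "\<exists>v. u \<le> v \<and> v + k * l \<le> u + l \<and> (\<Inter>n. bad x n) \<inter> {v..v + k * l} = {}"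
      by (intro exI[of _ v]) force
  qed
qed

lemma AE_not_bad: "x \<in> A \<Longrightarrow> AE y in lborel. y \<in> {0..c} \<longrightarrow> (\<exists>n. y \<notin> bad x n)"
proof -
  assume "x \<in> A"
  then obtain k where k: "0 < k" "\<And>u l. 0 < l \<Longrightarrow> 0 \<le> u \<Longrightarrow> u + l \<le> c \<Longrightarrow>
       \<exists>v. u \<le> v \<and> v + k * l \<le> u + l \<and> (\<Inter>n. bad x n) \<inter> {v..v + k * l} = {}"
    using bad_porous by blast
  have "measure lborel ((\<Inter>n. bad x n) \<inter> {0..c}) = 0"
    using c_gt_1 k by (intro measure_porous_zero[of _ k]) auto
  moreover have "(\<Inter>n. bad x n) \<inter> {0..c} \<in> fmeasurable lborel"
    by (intro fmeasurableI2[OF fmeasurable_cbox[of 0 c, simplified]]) auto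
  ultimately have "(\<Inter>n. bad x n) \<inter> {0..c} \<in> null_sets lborel"
    by (intro null_setsI) (auto simp: emeasure_eq_measure2)
  then show ?thesis
    by (rule AE_I') auto
qed

end

section \<open>A conjugate of modulus at least one\<close>

lemma emeasure_Ico_finite: "emeasure lborel {a..<b :: real} < top"
  by (cases "a \<le> b") auto

text \<open>\<open>R\<close> stands for the ring \<open>Z[q]\<close> and \<open>\<sigma>\<close> for
  the embedding sending \<open>q\<close> to \<open>z\<close>, reduced to additivity and the rule for
  multiplication by \<open>q\<close>.\<close>

locale conjugate_digit_sums = separated_digit_sums +
  fixes R :: "real set" and \<sigma> :: "real \<Rightarrow> complex" and z :: complex
  assumes R: "1 \<in> R" "\<And>x y. x \<in> R \<Longrightarrow> y \<in> R \<Longrightarrow> x + y \<in> R"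
      "\<And>x y. x \<in> R \<Longrightarrow> y \<in> R \<Longrightarrow> x - y \<in> R" "\<And>x. x \<in> R \<Longrightarrow> q * x \<in> R"
    and \<sigma>: "\<sigma> 1 = 1" "\<And>x y. x \<in> R \<Longrightarrow> y \<in> R \<Longrightarrow> \<sigma> (x + y) = \<sigma> x + \<sigma> y"
      "\<And>x y. x \<in> R \<Longrightarrow> y \<in> R \<Longrightarrow> \<sigma> (x - y) = \<sigma> x - \<sigma> y" "\<And>x. x \<in> R \<Longrightarrow> \<sigma> (q * x) = z * \<sigma> x"
    and z: "1 \<le> cmod z"
begin

lemma zero_in_R: "0 \<in> R" and \<sigma>_zero: "\<sigma> 0 = 0"
  using R(3)[OF R(1) R(1)] \<sigma>(3)[OF R(1) R(1)] by simp_all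

lemma R_power: "x \<in> R \<Longrightarrow> q ^ n * x \<in> R"
  by (induction n) (auto simp: mult.assoc R(4))

lemma \<sigma>_power: "x \<in> R \<Longrightarrow> \<sigma> (q ^ n * x) = z ^ n * \<sigma> x"
  by (induction n) (auto simp: mult.assoc \<sigma>(4) R_power)

lemma A_subset_R: "A \<subseteq> R"
proof -
  have "digit_sums q n \<subseteq> R" for n
    by (induction n) (auto simp: zero_in_R intro: R)
  then show ?thesis by (auto simp: A_def)
qed

text \<open>Differences in \<open>[0, 1]\<close> of points of \<open>A\<close> take finitely many
  values by \<open>finite_A_diff\<close>, and \<open>\<sigma>\<close> is additive.\<close>

lemma \<sigma>_near:
  obtains K where "0 \<le> K" "\<And>x y. x \<in> A \<Longrightarrow> y \<in> A \<Longrightarrow> \<bar>x - y\<bar> \<le> 1 \<Longrightarrow> cmod (\<sigma> x - \<sigma> y) \<le> K"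
proof -
  let ?D = "{x - y | x y. x \<in> A \<and> y \<in> A \<and> 0 \<le> x - y \<and> x - y \<le> 1}"
  define K where "K = (\<Sum>d\<in>?D. cmod (\<sigma> d))"
  have *: "cmod (\<sigma> x - \<sigma> y) \<le> K" if "x \<in> A" "y \<in> A" "0 \<le> x - y" "x - y \<le> 1" for x y
  proof -
    have "\<sigma> x - \<sigma> y = \<sigma> (x - y)" using that A_subset_R by (simp add: \<sigma>(3) subset_eq)
    also have "cmod \<dots> \<le> K"
      unfolding K_def using that by (intro member_le_sum finite_A_diff) auto
    finally show ?thesis .
  qed
  show ?thesis
  proof (rule that[of K])
    show "0 \<le> K" by (auto simp: K_def sum_nonneg)
    fix x y assume "x \<in> A" "y \<in> A" "\<bar>x - y\<bar> \<le> 1"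
    then show "cmod (\<sigma> x - \<sigma> y) \<le> K"
      using *[of x y] *[of y x] by (cases "y \<le> x") (auto simp: norm_minus_commute)
  qed
qed

section \<open>The step function of conjugates and its translations\<close>

text \<open>Truncation at 0 keeps the set non-empty, so that \<open>fl\<close> is monotone on the
  whole line.\<close>

definition fl :: "real \<Rightarrow> real" where "fl y = Max (A \<inter> {0..max 0 y})"

definition s :: "real \<Rightarrow> complex" where "s y = \<sigma> (fl y)"

lemma
  shows fl_in_A: "fl y \<in> A" and fl_upper: "a \<in> A \<Longrightarrow> a \<le> max 0 y \<Longrightarrow> a \<le> fl y"
    and fl_le: "fl y \<le> max 0 y"
proof -
  have fin: "finite (A \<inter> {0..max 0 y})" using finite_A_window[of 0 "max 0 y"] by simp
  have "0 \<in> A \<inter> {0..max 0 y}" using zero_in_A by simp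
  then have "fl y \<in> A \<inter> {0..max 0 y}" unfolding fl_def using Max_in[OF fin] by blast
  then show "fl y \<in> A" "fl y \<le> max 0 y" by auto
  show "a \<le> fl y" if "a \<in> A" "a \<le> max 0 y"
    unfolding fl_def using that A_nonneg by (intro Max_ge fin) auto
qed

lemma fl_gt: "0 \<le> y \<Longrightarrow> y < fl y + 1"
proof -
  assume "0 \<le> y"
  then obtain a where "a \<in> A" "a \<le> y" "y < a + 1" by (rule A_floor)
  moreover from this have "a \<le> fl y" by (intro fl_upper) auto
  ultimately show ?thesis by linarith
qed

lemma fl_mono: "mono fl"
  by (intro monoI fl_upper fl_in_A order_trans[OF fl_le]) auto

lemma s_measurable [measurable]: "s \<in> borel_measurable borel"
proof -
  have "fl \<in> borel_measurable borel" by (rule borel_measurable_mono[OF fl_mono])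
  then have "fl -` {a} \<in> sets borel" for a
    using measurable_sets_borel[of fl borel "{a}"] by simp
  then have "fl \<in> measurable borel (count_space A)"
    by (subst measurable_count_space_eq_countable[OF countable_A]) (auto simp: fl_in_A)
  then have "(\<lambda>y. \<sigma> (fl y)) \<in> borel_measurable borel"
    by (rule measurable_compose) simp
  then show ?thesis by (simp add: s_def[abs_def])
qed

lemma s_bounded: "\<exists>B. \<forall>y\<le>b. cmod (s y) \<le> B"
proof -
  let ?F = "A \<inter> {0..max 0 b}"
  have fin: "finite ?F" using finite_A_window[of 0 "max 0 b"] by simp
  have "cmod (s y) \<le> (\<Sum>a\<in>?F. cmod (\<sigma> a))" if "y \<le> b" for y
  proof -
    have "fl y \<in> ?F" using fl_in_A[of y] fl_le[of y] A_nonneg[OF fl_in_A] that by auto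
    then show ?thesis unfolding s_def by (intro member_le_sum fin) auto
  qed
  then show ?thesis by blast
qed

text \<open>At a position clean for \<open>x\<close> and for 0, the largest points of
  \<open>A\<close> below \<open>q ^ n * (x + y)\<close> and \<open>q ^ n * y\<close> are
  \<open>q ^ n * x + b\<close> and \<open>a\<close> with \<open>a\<close>, \<open>b\<close> of
  length \<open>n\<close>; by maximality each of \<open>a\<close>, \<open>b\<close> bounds the
  other.\<close>

lemma s_shift_clean:
  assumes "x \<in> A" "0 \<le> y" "y \<notin> bad x n" "y \<notin> bad 0 n"
  shows "s (q ^ n * (x + y)) = z ^ n * \<sigma> x + s (q ^ n * y)"
proof -
  have x: "0 \<le> x" using A_nonneg assms by blast
  have clean: "fl (q ^ n * (x' + y)) - q ^ n * x' \<in> digit_sums q n" if "0 \<le> x'" "y \<notin> bad x' n" for x'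
  proof -
    let ?Y = "q ^ n * (x' + y)"
    have "0 \<le> ?Y" using that q assms by simp
    then have "0 \<le> ?Y - fl ?Y" "?Y - fl ?Y \<le> c"
      using fl_le[of ?Y] fl_gt[of ?Y] c_gt_1 by auto
    then show ?thesis using that(2) fl_in_A[of ?Y] by (auto simp: bad_def)
  qed
  let ?b = "fl (q ^ n * (x + y)) - q ^ n * x" and ?a = "fl (q ^ n * y)"
  have b: "?b \<in> digit_sums q n" and a: "?a \<in> digit_sums q n"
    using clean[of x] clean[of 0] x assms by auto
  have pos: "0 \<le> q ^ n * (x + y)" "0 \<le> q ^ n * y" using q x assms by auto
  have "q ^ n * x + ?a \<le> fl (q ^ n * (x + y))"
    using A_append[OF assms(1) a] fl_le[of "q ^ n * y"] pos by (intro fl_upper) (auto simp: distrib_left)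
  moreover have "?b \<le> ?a"
    using b digit_sums_subset_A fl_le[of "q ^ n * (x + y)"] pos by (intro fl_upper) (auto simp: distrib_left)
  ultimately have "fl (q ^ n * (x + y)) = q ^ n * x + ?a" by simp
  then show ?thesis
    unfolding s_def using assms(1) A_subset_R fl_in_A by (auto simp: \<sigma>(2) R_power \<sigma>_power subset_iff)
qed

text \<open>The dominating bound for integration, uniform in \<open>n\<close>: for one greedy digit
  sum \<open>a\<close>, the two floors are within 1 of \<open>q ^ n * x + a\<close> and of
  \<open>a\<close>.\<close>

lemma s_shift_near:
  assumes K: "\<And>x y. x \<in> A \<Longrightarrow> y \<in> A \<Longrightarrow> \<bar>x - y\<bar> \<le> 1 \<Longrightarrow> cmod (\<sigma> x - \<sigma> y) \<le> K"
    and "x \<in> A" "0 \<le> y" "q ^ n * y < (q ^ n - 1) / (q - 1) + 1"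
  shows "cmod (s (q ^ n * (x + y)) - z ^ n * \<sigma> x - s (q ^ n * y)) \<le> 2 * K"
proof -
  have pos: "0 \<le> q ^ n * (x + y)" "0 \<le> q ^ n * y" using q A_nonneg[OF assms(2)] assms by auto
  obtain a where a: "a \<in> digit_sums q n" "a \<le> q ^ n * y" "q ^ n * y < a + 1"
    using digit_sums_floor[OF q pos(2) assms(4)] by blast
  have aA: "a \<in> A" "q ^ n * x + a \<in> A" using a digit_sums_subset_A A_append assms by auto
  have "cmod (\<sigma> (fl (q ^ n * (x + y))) - \<sigma> (q ^ n * x + a)) \<le> K"
    using aA a fl_in_A fl_le[of "q ^ n * (x + y)"] fl_gt[OF pos(1)] pos by (intro K) (auto simp: distrib_left)
  moreover have "cmod (\<sigma> a - \<sigma> (fl (q ^ n * y))) \<le> K"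
    using aA a fl_in_A fl_le[of "q ^ n * y"] fl_gt[OF pos(2)] pos by (intro K) auto
  moreover have "s (q ^ n * (x + y)) - z ^ n * \<sigma> x - s (q ^ n * y) =
      (\<sigma> (fl (q ^ n * (x + y))) - \<sigma> (q ^ n * x + a)) + (\<sigma> a - \<sigma> (fl (q ^ n * y)))"
    unfolding s_def using aA assms(2) A_subset_R by (auto simp: \<sigma>(2) R_power \<sigma>_power subset_iff)
  ultimately show ?thesis using norm_triangle_mono by fastforce
qed

text \<open>Vacuous outside \<open>[0, c]\<close>, so that it holds almost everywhere on the line
  and survives affine substitutions.\<close>

definition good :: "real \<Rightarrow> real \<Rightarrow> bool" where
  "good x y \<longleftrightarrow> (y \<in> {0..c} \<longrightarrow> (\<exists>n. y \<notin> bad x n))"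

lemma good_measurable [measurable]: "Measurable.pred borel (good x)"
proof -
  have "{y. good x y} = - ({0..c} \<inter> (\<Inter>n. bad x n))" by (auto simp: good_def)
  also have "\<dots> \<in> sets borel" by (intro borel_comp sets.Int sets.countable_INT) auto
  finally show ?thesis by (simp add: pred_def)
qed

lemma AE_good:
  assumes "x \<in> A" "b \<noteq> 0"
  shows "AE y in lborel. good x (t + b * y)"
  using assms AE_not_bad by (intro AE_borel_affine) (auto simp: good_def)

lemma eventually_s_shift:
  assumes "x \<in> A" "0 \<le> y" "y \<le> c" "good x y" "good 0 y"
  shows "\<forall>\<^sub>F n in sequentially. s (q ^ n * (x + y)) = z ^ n * \<sigma> x + s (q ^ n * y)"
proof -
  obtain n1 n2 where "y \<notin> bad x n1" "y \<notin> bad 0 n2" using assms by (auto simp: good_def)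
  then have "y \<notin> bad x n \<and> y \<notin> bad 0 n" if "n \<ge> max n1 n2" for n
    using that bad_antimono[of n1 n x] bad_antimono[of n2 n 0] by auto
  then show ?thesis
    using s_shift_clean[OF assms(1,2)] by (intro eventually_sequentiallyI[of "max n1 n2"]) auto
qed

section \<open>Integrals of the step function\<close>

lemma integral_error_tendsto_0:
  fixes g :: "nat \<Rightarrow> real \<Rightarrow> complex"
  assumes [measurable]: "\<And>n. g n \<in> borel_measurable borel"
    and ev: "AE y in lborel. y \<in> {a..<b} \<longrightarrow> (\<forall>\<^sub>F n in sequentially. g n y = 0)"
    and bd: "\<And>n y. n \<ge> n0 \<Longrightarrow> y \<in> {a..<b} \<Longrightarrow> cmod (g n y) \<le> B"
  shows "(\<lambda>n. \<integral>y. indicator {a..<b} y *\<^sub>R g n y \<partial>lborel) \<longlonglongrightarrow> 0"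
proof -
  have "(\<lambda>n. \<integral>y. indicator {a..<b} y *\<^sub>R g (n + n0) y \<partial>lborel) \<longlonglongrightarrow> (\<integral>y. 0 \<partial>(lborel :: real measure))"
  proof (rule integral_dominated_convergence[where w = "\<lambda>y. indicator {a..<b} y * B"])
    show "AE y in lborel. (\<lambda>n. indicator {a..<b} y *\<^sub>R g (n + n0) y) \<longlonglongrightarrow> 0"
      using ev
    proof eventually_elim
      case (elim y)
      show ?case
      proof (cases "y \<in> {a..<b}")
        case True
        then have "(\<lambda>n. g n y) \<longlonglongrightarrow> 0" using elim by (intro tendsto_eventually) auto
        then show ?thesis using True LIMSEQ_ignore_initial_segment[of "\<lambda>n. g n y" 0 n0] by simp
      qed simp
    qed
    show "AE y in lborel. norm (indicator {a..<b} y *\<^sub>R g (n + n0) y) \<le> indicator {a..<b} y * B" for n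
      using bd[of "n + n0"] by (intro AE_I2) (auto simp: indicator_def)
    show "integrable lborel (\<lambda>y. indicator {a..<b} y * B)"
      by (rule integrable_mult_left, rule integrable_real_indicator) (auto simp: emeasure_Ico_finite)
  qed simp_all
  then show ?thesis
    unfolding Bochner_Integration.integral_zero
    by (rule LIMSEQ_offset[where f = "\<lambda>n. \<integral>y. indicator {a..<b} y *\<^sub>R g n y \<partial>lborel"])
qed

definition J :: "nat \<Rightarrow> real \<Rightarrow> real \<Rightarrow> complex" where
  "J n a b = (\<integral>y. indicator {a..<b} y *\<^sub>R s (q ^ n * y) \<partial>lborel)"

lemma J_integrable: "integrable lborel (\<lambda>y. indicator {a..<b} y *\<^sub>R s (q ^ n * y))"
proof -
  obtain B where B: "\<And>y. y \<le> q ^ n * b \<Longrightarrow> cmod (s y) \<le> B" using s_bounded by blast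
  show ?thesis
  proof (rule Bochner_Integration.integrable_bound[of _ "\<lambda>y. indicator {a..<b} y * B"])
    show "integrable lborel (\<lambda>y. indicator {a..<b} y * B)"
      by (rule integrable_mult_left, rule integrable_real_indicator) (auto simp: emeasure_Ico_finite)
    have "norm (indicator {a..<b} y *\<^sub>R s (q ^ n * y)) \<le> norm (indicator {a..<b} y * B)" for y
    proof (cases "y \<in> {a..<b}")
      case True
      then have "cmod (s (q ^ n * y)) \<le> B" using q by (intro B mult_left_mono) auto
      then show ?thesis using True by simp
    qed simp
    then show "AE y in lborel. norm (indicator {a..<b} y *\<^sub>R s (q ^ n * y)) \<le> norm (indicator {a..<b} y * B)"
      by simp
  qed simp
qed

lemma J_split: "J n 0 (a + b) = J n 0 a + J n a (a + b)" if "0 \<le> a" "0 \<le> b"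
proof -
  have "J n 0 a + J n a (a + b) =
      (\<integral>y. indicator {0..<a} y *\<^sub>R s (q ^ n * y) + indicator {a..<a + b} y *\<^sub>R s (q ^ n * y) \<partial>lborel)"
    unfolding J_def by (intro Bochner_Integration.integral_add[symmetric] J_integrable)
  also have "\<dots> = J n 0 (a + b)"
    unfolding J_def using that by (intro Bochner_Integration.integral_cong) (auto simp: indicator_def)
  finally show ?thesis ..
qed

lemma J_shift:
  shows "integrable lborel (\<lambda>y. indicator {0..<b} y *\<^sub>R s (q ^ n * (y + t)))"
    and "(\<integral>y. indicator {0..<b} y *\<^sub>R s (q ^ n * (y + t)) \<partial>lborel) = J n t (t + b)"
proof -
  have eq: "indicator {t..<t + b} (t + 1 * y) *\<^sub>R s (q ^ n * (t + 1 * y)) = indicator {0..<b} y *\<^sub>R s (q ^ n * (y + t))" for y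
    by (auto simp: indicator_def add.commute)
  show "integrable lborel (\<lambda>y. indicator {0..<b} y *\<^sub>R s (q ^ n * (y + t)))"
    using lborel_integrable_real_affine[OF J_integrable[of t "t + b" n], of 1 t] by (simp only: eq)
  show "(\<integral>y. indicator {0..<b} y *\<^sub>R s (q ^ n * (y + t)) \<partial>lborel) = J n t (t + b)"
    unfolding J_def
    using lborel_integral_real_affine[of 1 "\<lambda>y. indicator {t..<t + b} y *\<^sub>R s (q ^ n * y)" t] by (simp only: eq) simp
qed

lemma integral_shift_error:
  assumes "0 \<le> b"
  shows "(\<integral>y. indicator {0..<b} y *\<^sub>R (s (q ^ n * (y + t)) - s (q ^ n * y) - w) \<partial>lborel)
    = J n t (t + b) - J n 0 b - of_real b * w"
proof -
  have int: "integrable lborel (\<lambda>y. indicator {0..<b} y *\<^sub>R w)"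
    by (rule integrable_scaleR_left, rule integrable_real_indicator) (auto simp: emeasure_Ico_finite)
  have "(\<integral>y. indicator {0..<b} y *\<^sub>R w \<partial>lborel) = of_real b * w"
    using assms by (subst integral_scaleR_left) (auto simp: scaleR_conv_of_real emeasure_Ico_finite)
  then show ?thesis
    by (simp add: scaleR_diff_right J_integrable J_shift int J_def[symmetric]
        Bochner_Integration.integral_diff Bochner_Integration.integrable_diff)
qed

text \<open>Both \<open>v\<close> and \<open>1/q\<close> act, up to negligible errors, as translations on
  \<open>S y = s (q\<^sup>n y)\<close>, and translating \<open>[0,1/q)\<close> by \<open>v\<close> or \<open>[0,v)\<close> by \<open>1/q\<close> changes the integral
  of \<open>S\<close> by the same amount.\<close>

lemma \<sigma>_proportional:
  assumes xx': "x \<in> A" "x' \<in> A" and v: "v = x' - x" "0 < v" "q * v < c"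
  shows "z * \<sigma> v = of_real (q * v)"
proof -
  obtain K where K: "0 \<le> K" "\<And>x y. x \<in> A \<Longrightarrow> y \<in> A \<Longrightarrow> \<bar>x - y\<bar> \<le> 1 \<Longrightarrow> cmod (\<sigma> x - \<sigma> y) \<le> K"
    using \<sigma>_near by blast
  define r where "r = 1 / q"
  have r: "0 < r" "q * r = 1" using q by (auto simp: r_def)
  have \<sigma>v: "\<sigma> v = \<sigma> x' - \<sigma> x" using xx' A_subset_R by (auto simp: v \<sigma>(3) subset_eq)
  have "q * (v + r) < q * c" using v r q_times_c by (simp add: distrib_left)
  then have vr: "v + r < c" using q by simp
  obtain m1 where m1: "\<And>n. m1 \<le> n \<Longrightarrow> (v + r) * q ^ n + 0 \<le> (q ^ n - 1) / (q - 1)"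
    using power_max_large[OF vr, of 0] by blast
  obtain m2 where m2: "\<And>n. m2 \<le> n \<Longrightarrow> (q * v) * q ^ n + 0 \<le> (q ^ n - 1) / (q - 1)"
    using power_max_large[OF v(3), of 0] by blast
  define g where "g n y = s (q ^ n * (y + v)) - s (q ^ n * y) - z ^ n * \<sigma> v" for n y
  define h where "h n y = s (q ^ Suc n * (y + r)) - s (q ^ Suc n * y) - z ^ n" for n y
  \<comment> \<open>\<open>v\<close> is only a difference of points of \<open>A\<close>, so
    translation by \<open>v\<close> is compared through two steps from \<open>A\<close>: by
    \<open>x'\<close> from \<open>y\<close> and by \<open>x\<close> from \<open>v + y\<close>, which
    arrive at the same position.\<close>
  have g: "g n y = (s (q ^ n * (x' + y)) - z ^ n * \<sigma> x' - s (q ^ n * y))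
      - (s (q ^ n * (x + (v + y))) - z ^ n * \<sigma> x - s (q ^ n * (v + y)))" for n y
  proof -
    have eq: "x + (v + y) = x' + y" by (simp add: v)
    show ?thesis unfolding eq g_def \<sigma>v by (simp add: add.commute[of y v] right_diff_distrib)
  qed
  \<comment> \<open>One factor \<open>q\<close> turns translation by \<open>1 / q\<close> at level
    \<open>n + 1\<close> into translation by the point 1 of \<open>A\<close> at level
    \<open>n\<close>.\<close>
  have h: "h n y = s (q ^ n * (1 + q * y)) - z ^ n * \<sigma> 1 - s (q ^ n * (q * y))" for n y
  proof -
    have "q ^ Suc n * (y + r) = q ^ n * (q * y + q * r)" by (simp add: algebra_simps)
    then have e1: "q ^ Suc n * (y + r) = q ^ n * (1 + q * y)" unfolding r(2) add.commute[of "q * y"] .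
    have e2: "q ^ Suc n * y = q ^ n * (q * y)" by simp
    show ?thesis unfolding h_def \<sigma>(1) e1 e2 by simp
  qed
  have "(\<lambda>n. \<integral>y. indicator {0..<r} y *\<^sub>R g n y \<partial>lborel) \<longlonglongrightarrow> 0"
  proof (rule integral_error_tendsto_0)
    show "g n \<in> borel_measurable borel" for n unfolding g_def by measurable
    have "AE y in lborel. good x (v + 1 * y) \<and> good 0 (v + 1 * y) \<and> good x' (0 + 1 * y) \<and> good 0 (0 + 1 * y)"
      using xx' zero_in_A by (intro AE_conjI AE_good) auto
    then show "AE y in lborel. y \<in> {0..<r} \<longrightarrow> (\<forall>\<^sub>F n in sequentially. g n y = 0)"
    proof eventually_elim
      case (elim y)
      show ?case
      proof
        assume "y \<in> {0..<r}"
        then have "\<forall>\<^sub>F n in sequentially. s (q ^ n * (x + (v + y))) = z ^ n * \<sigma> x + s (q ^ n * (v + y))"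
          "\<forall>\<^sub>F n in sequentially. s (q ^ n * (x' + y)) = z ^ n * \<sigma> x' + s (q ^ n * y)"
          using elim xx' v(2) vr by (intro eventually_s_shift; simp)+
        then show "\<forall>\<^sub>F n in sequentially. g n y = 0" by eventually_elim (simp add: g)
      qed
    qed
    fix n y assume n: "m1 \<le> n" and y: "y \<in> {0..<r}"
    have "q ^ n * y' < (q ^ n - 1) / (q - 1) + 1" if "y' \<le> v + r" for y'
    proof -
      have "q ^ n * y' \<le> q ^ n * (v + r)" using that q by (intro mult_left_mono) auto
      also have "\<dots> = (v + r) * q ^ n + 0" by simp
      also have "\<dots> \<le> (q ^ n - 1) / (q - 1)" by (rule m1[OF n])
      finally show ?thesis by simp
    qed
    then have "cmod (s (q ^ n * (x' + y)) - z ^ n * \<sigma> x' - s (q ^ n * y)) \<le> 2 * K"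
      "cmod (s (q ^ n * (x + (v + y))) - z ^ n * \<sigma> x - s (q ^ n * (v + y))) \<le> 2 * K"
      using y v by (intro s_shift_near[OF K(2)] xx'; simp)+
    then show "cmod (g n y) \<le> 2 * K + 2 * K" unfolding g by (rule norm_triangle_le_diff[OF add_mono])
  qed
  \<comment> \<open>Reindexed to level \<open>n + 1\<close>, so that this limit and the one for
    \<open>h\<close> concern the same function.\<close>
  then have G: "(\<lambda>n. J (Suc n) v (v + r) - J (Suc n) 0 r - of_real r * (z ^ Suc n * \<sigma> v)) \<longlonglongrightarrow> 0"
    using r by (subst (asm) filterlim_sequentially_Suc[symmetric]) (simp only: g_def integral_shift_error less_imp_le)
  have "(\<lambda>n. \<integral>y. indicator {0..<v} y *\<^sub>R h n y \<partial>lborel) \<longlonglongrightarrow> 0"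
  proof (rule integral_error_tendsto_0)
    show "h n \<in> borel_measurable borel" for n unfolding h_def by measurable
    have "AE y in lborel. good 1 (0 + q * y) \<and> good 0 (0 + q * y)"
      using q zero_in_A one_in_A by (intro AE_conjI AE_good) auto
    then show "AE y in lborel. y \<in> {0..<v} \<longrightarrow> (\<forall>\<^sub>F n in sequentially. h n y = 0)"
    proof eventually_elim
      case (elim y)
      show ?case
      proof
        assume y: "y \<in> {0..<v}"
        then have "q * y \<le> q * v" using q by simp
        then have "q * y \<le> c" using v(3) by linarith
        then have "\<forall>\<^sub>F n in sequentially. s (q ^ n * (1 + q * y)) = z ^ n * \<sigma> 1 + s (q ^ n * (q * y))"
          using elim y q one_in_A by (intro eventually_s_shift) auto
        then show "\<forall>\<^sub>F n in sequentially. h n y = 0" by eventually_elim (simp add: h)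
      qed
    qed
    fix n y assume n: "m2 \<le> n" and y: "y \<in> {0..<v}"
    have "q ^ n * (q * y) \<le> q ^ n * (q * v)" using y q by simp
    then have "q ^ n * (q * y) < (q ^ n - 1) / (q - 1) + 1"
      using m2[OF n] by (simp add: mult_ac)
    then show "cmod (h n y) \<le> 2 * K"
      unfolding h using y q by (intro s_shift_near[OF K(2)] one_in_A) auto
  qed
  then have H: "(\<lambda>n. J (Suc n) r (r + v) - J (Suc n) 0 v - of_real v * z ^ n) \<longlonglongrightarrow> 0"
    using v by (simp only: h_def integral_shift_error less_imp_le)
  have "J n v (v + r) - J n 0 r = J n r (r + v) - J n 0 v" for n
    using J_split[of v r n] J_split[of r v n] v(2) r(1) by (simp add: add.commute algebra_simps)
  then have "(\<lambda>n. z ^ n * (of_real v - of_real r * (z * \<sigma> v))) \<longlonglongrightarrow> 0"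
    using tendsto_diff[OF G H] by (simp add: algebra_simps)
  then have "(\<lambda>n. cmod (z ^ n * (of_real v - of_real r * (z * \<sigma> v)))) \<longlonglongrightarrow> 0"
    using tendsto_norm_zero by blast
  \<comment> \<open>Here \<open>1 \<le> cmod z\<close> prevents the factor \<open>z ^ n\<close> from
    hiding a non-zero constant.\<close>
  moreover have "cmod (of_real v - of_real r * (z * \<sigma> v)) \<le> cmod (z ^ n * (of_real v - of_real r * (z * \<sigma> v)))" for n
    using one_le_power[OF z, of n] by (simp add: norm_mult norm_power mult_right_mono mult_le_cancel_right1)
  ultimately have "cmod (of_real v - of_real r * (z * \<sigma> v)) \<le> 0"
    by (intro LIMSEQ_le_const) auto
  then have "complex_of_real v = of_real r * (z * \<sigma> v)" by simp
  then have "complex_of_real (q * v) = of_real (q * r) * (z * \<sigma> v)" by simp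
  then show ?thesis by (simp add: r(2))
qed

section \<open>Differences that force an equation for \<open>q\<close>\<close>

text \<open>Closed form of a single power minus the sum of all lower ones,
  \<open>q ^ j - q ^ (j - 1) - ... - 1\<close>.\<close>

definition v :: "nat \<Rightarrow> real" where "v j = q ^ j - (q ^ j - 1) * c"

lemma v_0: "v 0 = 1" and v_Suc: "v (Suc j) = q * v j - 1"
proof -
  show "v 0 = 1" by (simp add: v_def)
  have "q * v j - 1 = q ^ Suc j - q ^ Suc j * c + (q * c - 1)"
    by (simp add: v_def algebra_simps)
  also have "\<dots> = v (Suc j)" by (simp add: v_def q_times_c algebra_simps)
  finally show "v (Suc j) = q * v j - 1" ..
qed

lemma v_step: "v i - v (Suc i) > 0"
proof -
  have "v i - v (Suc i) = q ^ i * ((q - 1) * (c - 1))" by (simp add: v_def algebra_simps)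
  then show ?thesis using q c_gt_1 by simp
qed

lemma v_diff:
  obtains x y where "x \<in> A" "y \<in> A" "v j = x - y"
proof (rule that)
  show "q ^ j * 1 + 0 \<in> A" using A_append[OF one_in_A zero_in_digit_sums] .
  show "(q ^ j - 1) / (q - 1) \<in> A" using max_in_digit_sums[OF q] digit_sums_subset_A by blast
  show "v j = q ^ j * 1 + 0 - (q ^ j - 1) / (q - 1)" by (simp add: v_def c_def)
qed

lemma v_in_R: "v j \<in> R"
  using v_diff[of j] A_subset_R R(3) by (metis subsetD)

context
  assumes z_ne_q: "z \<noteq> of_real q"
begin

text \<open>By \<open>\<sigma>_proportional\<close>, \<open>\<sigma>\<close> fixes
  \<open>q * u\<close>, hence also \<open>q * u - 1\<close> and \<open>1 - q * u\<close>. All three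
  are differences of points of \<open>A\<close>, and a positive one below \<open>c / q\<close> that
  is fixed by \<open>\<sigma>\<close> would give \<open>z = q\<close>. Unless
  \<open>q * u = 1\<close>, one of them is of this kind.\<close>

lemma small_diff_unique:
  assumes "x \<in> A" "y \<in> A" "u = x - y" "0 < u" "q * u < c"
  shows "q * u = 1"
proof (rule ccontr)
  assume ne: "q * u \<noteq> 1"
  have xy: "q * x \<in> A" "q * y \<in> A" "q * x + 1 \<in> A" "q * y + 1 \<in> A"
    using A_digit[of _ 0] A_digit[of _ 1] assms by auto
  have uR: "u \<in> R" using assms A_subset_R R(3) by auto
  have "z * \<sigma> u = of_real (q * u)" using \<sigma>_proportional[of y x u] assms by blast
  then have \<sigma>qu: "\<sigma> (q * u) = of_real (q * u)" using uR by (simp add: \<sigma>)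
  have absurd: False if "a \<in> A" "b \<in> A" "w = a - b" "0 < w" "q * w < c" "\<sigma> w = of_real w" for a b w
  proof -
    have "z * of_real w = of_real q * of_real w"
      using \<sigma>_proportional[of b a w] that by simp
    then show False using z_ne_q that by simp
  qed
  show False
  proof (cases "q * (q * u) < c")
    case True
    then show False
      using absurd[of "q * x" "q * y" "q * u"] xy assms \<sigma>qu q by (simp add: right_diff_distrib)
  next
    case False
    have \<sigma>1: "\<sigma> (q * u - 1) = of_real (q * u - 1)" "\<sigma> (1 - q * u) = of_real (1 - q * u)"
      using \<sigma>(3)[OF R(4)[OF uR] R(1)] \<sigma>(3)[OF R(1) R(4)[OF uR]] \<sigma>qu \<sigma>(1) by simp_all
    have "q * (q * u - 1) < q * (c - 1)" using assms q by simp
    then have b1: "q * (q * u - 1) < c" using q_times_c q by (simp add: right_diff_distrib)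
    have b2: "q * (1 - q * u) < c" using False q c_gt_1 by (simp add: right_diff_distrib)
    show False
    proof (cases "q * u > 1")
      case True
      then show False
        using absurd[of "q * x" "q * y + 1" "q * u - 1"] xy assms(3) b1 \<sigma>1 by (simp add: right_diff_distrib)
    next
      case False
      then show False
        using absurd[of "q * y + 1" "q * x" "1 - q * u"] ne xy assms(3) b2 \<sigma>1 by (simp add: right_diff_distrib)
    qed
  qed
qed

text \<open>\<open>v\<close> eventually becomes negative, so there is a first \<open>j\<close> with
  \<open>q * v j < c\<close>. Before it, \<open>c \<le> q * v k\<close> keeps the successor
  positive; so \<open>v j\<close> is a small positive difference and
  \<open>q * v j = 1\<close>.\<close>

lemma v_vanishes:
  obtains j where "v (Suc j) = 0" "\<And>i. i \<le> j \<Longrightarrow> 0 < v i"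
proof -
  have v_alt: "v j = c - q ^ j * (c - 1)" for j by (simp add: v_def algebra_simps)
  obtain j0 where "c / (c - 1) < q ^ j0" using real_arch_pow[OF q(1)] by blast
  then have "v j0 < 0" using c_gt_1 by (simp add: v_alt field_simps)
  then have "q * v j0 < c" using q c_gt_1 mult_pos_neg[of q "v j0"] by simp
  then obtain j where j: "q * v j < c" "\<And>i. i < j \<Longrightarrow> \<not> q * v i < c"
    using exists_least_iff[of "\<lambda>j. q * v j < c"] by auto
  have pos: "0 < v i" if "i \<le> j" for i
  proof (cases i)
    case (Suc k)
    then have "c \<le> q * v k" using j(2)[of k] that by simp
    then show ?thesis using Suc c_gt_1 by (simp add: v_Suc)
  qed (simp add: v_0)
  obtain x y where "x \<in> A" "y \<in> A" "v j = x - y" by (rule v_diff)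
  then have "q * v j = 1" using small_diff_unique[of x y "v j"] pos[of j] j(1) by blast
  then show ?thesis using that[of j] pos by (simp add: v_Suc)
qed

text \<open>So \<open>q\<close> is a root of \<open>x\<^sup>j\<^sup>+\<^sup>1 = x\<^sup>j + \<dots> + 1\<close>; dividing by \<open>x - q\<close> leaves the
  coefficients \<open>v 0 > v 1 > \<dots> > v j > 0\<close>, and the Enestrom-Kakeya argument applies.\<close>

lemma conjugate_absurd: False
proof -
  obtain j where j: "v (Suc j) = 0" "\<And>i. i \<le> j \<Longrightarrow> 0 < v i" using v_vanishes by blast
  define w where "w = 1 / z"
  have z0: "z \<noteq> 0" using z by auto
  have zw: "z * w = 1" using z0 by (simp add: w_def)
  have w: "cmod w \<le> 1" using z by (simp add: w_def norm_divide divide_le_eq)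
  have \<sigma>v: "\<sigma> (v (Suc n)) = z * \<sigma> (v n) - 1" for n
    unfolding v_Suc using \<sigma>(3)[OF R(4)[OF v_in_R] R(1)] \<sigma>(4)[OF v_in_R] \<sigma>(1) by simp
  \<comment> \<open>Synthetic division by \<open>x - q\<close> of the polynomial in \<open>q\<close>
    defining \<open>v n\<close>, evaluated at \<open>z\<close> and multiplied by
    \<open>w ^ n\<close>.\<close>
  have D: "w ^ n * (\<sigma> (v n) - of_real (v n)) = (z - of_real q) * w * (\<Sum>i<n. of_real (v i) * w ^ i)" for n
  proof (induction n)
    case 0
    then show ?case by (simp add: v_0 \<sigma>(1))
  next
    case (Suc n)
    have "\<sigma> (v (Suc n)) - of_real (v (Suc n)) = z * (\<sigma> (v n) - of_real (v n)) + (z - of_real q) * of_real (v n)"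
      unfolding \<sigma>v by (simp add: v_Suc algebra_simps)
    then have "w ^ Suc n * (\<sigma> (v (Suc n)) - of_real (v (Suc n))) =
        w ^ Suc n * (z * (\<sigma> (v n) - of_real (v n)) + (z - of_real q) * of_real (v n))" by simp
    then have "w ^ Suc n * (\<sigma> (v (Suc n)) - of_real (v (Suc n))) =
        (z * w) * (w ^ n * (\<sigma> (v n) - of_real (v n))) + (z - of_real q) * w * (of_real (v n) * w ^ n)"
      by (simp add: algebra_simps)
    then show ?case by (simp add: zw Suc distrib_left)
  qed
  have "w \<noteq> 0" using z0 by (simp add: w_def)
  then have S0: "(\<Sum>i<Suc j. of_real (v i) * w ^ i) = 0"
    using D[of "Suc j"] z_ne_q j(1) \<sigma>_zero by simp
  have "(1 - w) * (\<Sum>i<n. of_real (v i) * w ^ i) =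
      1 - of_real (v n) * w ^ n - (\<Sum>i<n. of_real (v i - v (Suc i)) * w ^ Suc i)" for n
    by (induction n) (auto simp: v_0 algebra_simps)
  from this[of "Suc j"] have "(\<Sum>i<Suc j. of_real (v i - v (Suc i)) * w ^ Suc i) = 1"
    using S0 j(1) by (simp del: sum.lessThan_Suc)
  then have "Re (\<Sum>i<Suc j. of_real (v i - v (Suc i)) * w ^ Suc i) = 1" by simp
  moreover have "Re (of_real a * u) = a * Re u" for a u by simp
  ultimately have "(\<Sum>i<Suc j. (v i - v (Suc i)) * Re (w ^ Suc i)) = 1" by (simp only: Re_sum)
  moreover have "(\<Sum>i<Suc j. v i - v (Suc i)) = 1"
    using sum_lessThan_telescope'[of v "Suc j"] j(1) v_0 by (simp del: sum.lessThan_Suc)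
  \<comment> \<open>The positive weights \<open>v i - v (Suc i)\<close> have sum 1 and the weighted
    mean of the points \<open>w ^ Suc i\<close> of the closed unit disc is 1, so each of them, in
    particular \<open>w\<close>, has real part 1.\<close>
  ultimately have "(\<Sum>i<Suc j. (v i - v (Suc i)) * (1 - Re (w ^ Suc i))) = 0"
    by (simp add: right_diff_distrib sum_subtractf del: sum.lessThan_Suc power_Suc)
  moreover have "0 \<le> (v i - v (Suc i)) * (1 - Re (w ^ Suc i))" for i
  proof -
    have "Re (w ^ Suc i) \<le> cmod (w ^ Suc i)" by (rule complex_Re_le_cmod)
    also have "\<dots> \<le> 1" unfolding norm_power using w by (intro power_le_one) auto
    finally show ?thesis using v_step[of i] by simp
  qed
  ultimately have "\<forall>i\<in>{..<Suc j}. (v i - v (Suc i)) * (1 - Re (w ^ Suc i)) = 0"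
    by (subst (asm) sum_nonneg_eq_0_iff) auto
  then have "Re w = 1" using v_step[of 0] by force
  moreover have "(Re w)\<^sup>2 + (Im w)\<^sup>2 \<le> 1"
    using w unfolding cmod_power2[symmetric] by (intro power_le_one) auto
  ultimately have "w = 1" by (simp add: complex_eq_iff)
  then have "complex_of_real (\<Sum>i<Suc j. v i) = 0" using S0 by (simp del: sum.lessThan_Suc)
  moreover have "(\<Sum>i<Suc j. v i) > 0" using j(2) by (intro sum_pos) auto
  ultimately show False by (metis of_real_eq_0_iff less_irrefl)
qed

end

end

section \<open>Non-Pisot bases\<close>

abbreviation ev :: "int poly \<Rightarrow> 'a :: comm_ring_1 \<Rightarrow> 'a" where
  "ev p x \<equiv> poly (map_poly of_int p) x"

lemma ev_pCons: "ev (pCons a p) x = of_int a + x * ev p x"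
  by (cases "pCons a p = 0") (auto simp: map_poly_pCons)

lemma ev_const: "ev [:a:] x = of_int a"
  by (simp add: ev_pCons)

lemma ev_simps:
  "ev (p + r) x = ev p x + ev r x" "ev (p - r) x = ev p x - ev r x" "ev (smult a p) x = of_int a * ev p x"
  "ev (p * r) x = ev p x * ev r x"
proof -
  show add: "ev (p + r) x = ev p x + ev r x" for p r
    by (induction p r rule: poly_induct2) (auto simp: ev_pCons algebra_simps)
  show "ev (p - r) x = ev p x - ev r x"
    using add[of "p - r" r] by (simp add: algebra_simps)
  show smult: "ev (smult a p) x = of_int a * ev p x" for a p
    by (induction p) (auto simp: ev_pCons algebra_simps)
  show "ev (p * r) x = ev p x * ev r x"
    by (induction p) (auto simp: ev_pCons add smult algebra_simps)
qed

lemma ev_of_real: "ev p (of_real x :: complex) = of_real (ev p x)"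
  by (induction p) (auto simp: ev_pCons)

section \<open>Integer polynomials and conjugates\<close>

text \<open>Take \<open>p\<close> monic of least degree vanishing at \<open>x\<close>. In a
  factorisation the leading coefficients are both 1 or both -1; the factor vanishing at
  \<open>x\<close>, made monic, has full degree, so the other is a constant unit.\<close>

lemma monic_minimal_irreducible:
  fixes x :: "'a :: {idom, ring_char_0}" and f :: "int poly"
  assumes "lead_coeff f = 1" "ev f x = 0"
  obtains p where "lead_coeff p = 1" "irreducible p" "ev p x = 0"
proof -
  define P where "P p \<longleftrightarrow> lead_coeff p = 1 \<and> ev p x = 0" for p
  obtain p where p: "P p" "\<And>r. P r \<Longrightarrow> degree p \<le> degree r"
    using assms ex_has_least_nat[of P f degree] by (auto simp: P_def)
  have p0: "p \<noteq> 0" using p(1) by (auto simp: P_def)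
  have deg: "degree p \<noteq> 0"
  proof
    assume "degree p = 0"
    then have "p = [:1:]" using p(1) by (auto simp: P_def elim: degree_eq_zeroE)
    then show False using p(1) by (simp add: P_def ev_const)
  qed
  have unit: "b dvd 1" if ab: "p = a * b" "ev a x = 0" for a b
  proof -
    have lc: "lead_coeff a * lead_coeff b = 1" using p(1) ab by (simp add: P_def lead_coeff_mult)
    then have la: "lead_coeff a * lead_coeff a = 1" "lead_coeff b dvd 1"
      by (auto simp: zmult_eq_1_iff)
    have "a \<noteq> 0" "b \<noteq> 0" using ab p0 by auto
    then have "degree p = degree a + degree b" using ab by (simp add: degree_mult_eq)
    moreover have "P (smult (lead_coeff a) a)"
      using la ab by (auto simp: P_def ev_simps)
    then have "degree p \<le> degree a" using p(2)[of "smult (lead_coeff a) a"] \<open>a \<noteq> 0\<close> by simp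
    ultimately have "degree b = 0" by simp
    then obtain k where "b = [:k:]" by (rule degree_eq_zeroE)
    then show ?thesis using la by (simp add: is_unit_const_poly_iff)
  qed
  have "irreducible p"
  proof (rule irreducibleI)
    show "p \<noteq> 0" by (rule p0)
    show "\<not> p dvd 1" using deg by (auto dest: divides_degree)
    fix a b assume ab: "p = a * b"
    then have "ev a x = 0 \<or> ev b x = 0" using p(1) by (auto simp: P_def ev_simps)
    then show "a dvd 1 \<or> b dvd 1" using unit[of a b] unit[of b a] ab by (auto simp: mult.commute)
  qed
  then show ?thesis using that[of p] p(1) unfolding P_def by blast
qed

text \<open>Let \<open>r\<close> be non-zero of least degree vanishing at \<open>x\<close>.
  Pseudo-division stays within integer polynomials: every \<open>f\<close> vanishing at
  \<open>x\<close> has a non-zero multiple \<open>smult k f\<close> divisible by \<open>r\<close>.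
  For \<open>f = p\<close>, which is prime, this gives \<open>p dvd r\<close>, as
  \<open>p dvd s\<close> would make the non-constant \<open>r\<close> divide a constant. So
  \<open>r\<close>, and with it \<open>g\<close>, vanishes at \<open>y\<close>.\<close>

lemma ev_eq_0_transfer:
  fixes x :: "'a :: {idom, ring_char_0}" and y :: "'b :: {idom, ring_char_0}"
  assumes p: "irreducible p" "ev p x = 0" "ev p y = 0" and g: "ev g x = 0"
  shows "ev g y = 0"
proof -
  define P where "P r \<longleftrightarrow> r \<noteq> 0 \<and> ev r x = 0" for r
  have p0: "p \<noteq> 0" using p by auto
  obtain r where r: "P r" "\<And>s. P s \<Longrightarrow> degree r \<le> degree s"
    using ex_has_least_nat[of P p degree] p p0 by (auto simp: P_def)
  have r0: "r \<noteq> 0" "ev r x = 0" using r(1) by (auto simp: P_def)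
  have deg: "degree r \<noteq> 0"
  proof
    assume "degree r = 0"
    then obtain k where "r = [:k:]" by (rule degree_eq_zeroE)
    then show False using r0 by (simp add: ev_const)
  qed
  have dvd: "\<exists>k s. k \<noteq> 0 \<and> smult k f = r * s" if f: "ev f x = 0" for f
  proof -
    obtain s t where st: "pseudo_divmod f r = (s, t)" by force
    let ?k = "coeff r (degree r) ^ (Suc (degree f) - degree r)"
    have eq: "smult ?k f = r * s + t" and t: "t = 0 \<or> degree t < degree r"
      using pseudo_divmod[OF r0(1) st] by auto
    have "ev (smult ?k f) x = ev (r * s + t) x" by (simp only: eq)
    then have "ev t x = 0" using f r0 by (simp add: ev_simps)
    then have "t = 0" using t r(2)[of t] unfolding P_def by linarith
    then show ?thesis using eq r0 by (intro exI[of _ ?k] exI[of _ s]) auto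
  qed
  have "prime_elem p" using p(1) by (rule irreducible_imp_prime_elem)
  obtain k s where ks: "k \<noteq> 0" "smult k p = r * s" using dvd[OF p(2)] by blast
  have "p dvd r * s" by (metis ks(2) dvd_smult dvd_refl)
  then have "p dvd r \<or> p dvd s" using \<open>prime_elem p\<close> prime_elem_dvd_multD by blast
  moreover have "\<not> p dvd s"
  proof
    assume "p dvd s"
    then obtain u where "s = p * u" by (rule dvdE)
    then have "p * [:k:] = p * (r * u)" using ks(2) by (simp add: mult_ac)
    then have "[:k:] = r * u" using p0 by (simp only: mult_cancel_left) auto
    moreover from this have "u \<noteq> 0" using ks(1) by auto
    ultimately have "degree [:k:] = degree r + degree u" using r0 by (metis degree_mult_eq)
    then show False using deg by simp
  qed
  ultimately have ry: "ev r y = 0" using p(3) by (auto simp: dvd_def ev_simps)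
  obtain k s where ks: "k \<noteq> 0" "smult k g = r * s" using dvd[OF g] by blast
  have "ev (smult k g) y = ev (r * s) y" by (simp only: ks)
  then show ?thesis using ry ks(1) by (simp add: ev_simps)
qed

text \<open>Expand 1 in base \<open>q\<close>: the remainders \<open>r i\<close> stay in
  \<open>[0, 1]\<close> and are differences of points of \<open>A\<close>, so some value recurs.
  \<open>P i\<close> is monic of degree \<open>i\<close> with value \<open>r i\<close> at
  \<open>q\<close>; a repetition makes \<open>P j - P i\<close> the required polynomial.\<close>

lemma (in separated_digit_sums) algebraic_integer:
  obtains f :: "int poly" where "lead_coeff f = 1" "ev f q = 0"
proof -
  define r where "r = rec_nat 1 (\<lambda>_ t. if q * t > 1 then q * t - 1 else q * t)"
  have r: "r 0 = 1" "r (Suc i) = (if q * r i > 1 then q * r i - 1 else q * r i)" for i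
    by (simp_all add: r_def)
  define P where "P = rec_nat 1 (\<lambda>i t. pCons (if q * r i > 1 then - 1 else 0 :: int) t)"
  have P: "P 0 = 1" "P (Suc i) = pCons (if q * r i > 1 then - 1 else 0) (P i)" for i
    by (simp_all add: P_def)
  let ?D = "{x - y | x y. x \<in> A \<and> y \<in> A \<and> 0 \<le> x - y \<and> x - y \<le> 1}"
  have bds: "0 \<le> r i \<and> r i \<le> 1" for i
  proof (induction i)
    case (Suc i)
    have "q * r i \<le> q" using Suc q by (simp add: mult_left_le)
    then have "q * r i \<le> 2" using q by linarith
    then show ?case using Suc q by (auto simp: r)
  qed (simp add: r)
  have diff: "\<exists>x\<in>A. \<exists>y\<in>A. r i = x - y" for i
  proof (induction i)
    case 0
    show ?case using zero_in_A one_in_A by (intro bexI[of _ 1] bexI[of _ 0]) (auto simp: r)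
  next
    case (Suc i)
    then obtain x y where xy: "x \<in> A" "y \<in> A" "r i = x - y" by blast
    have *: "q * x \<in> A" "q * y \<in> A" "q * y + 1 \<in> A" using A_digit[of _ 0] A_digit[of _ 1] xy by auto
    show ?case
    proof (cases "q * r i > 1")
      case True
      then show ?thesis using * xy by (intro bexI[of _ "q * x"] bexI[of _ "q * y + 1"]) (auto simp: r algebra_simps)
    next
      case False
      then show ?thesis using * xy by (intro bexI[of _ "q * x"] bexI[of _ "q * y"]) (auto simp: r algebra_simps)
    qed
  qed
  have "range r \<subseteq> ?D"
  proof safe
    fix i
    obtain x y where "x \<in> A" "y \<in> A" "r i = x - y" using diff by blast
    then show "\<exists>x y. r i = x - y \<and> x \<in> A \<and> y \<in> A \<and> 0 \<le> x - y \<and> x - y \<le> 1"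
      using bds[of i] by auto
  qed
  then have "finite (range r)" using finite_A_diff finite_subset by blast
  then have "\<not> inj r" using finite_imageD infinite_UNIV_nat by blast
  then obtain i j where ij: "r i = r j" "i < j" by (metis injI linorder_neqE_nat)
  have deg: "degree (P i) = i \<and> coeff (P i) i = 1" for i
    by (induction i) (auto simp: P)
  have ev: "ev (P i) q = r i" for i
    by (induction i) (auto simp: P r ev_pCons)
  have "degree (P j - P i) = j"
    using deg ij(2) degree_add_eq_left[of "- P i" "P j"] by simp
  moreover have "coeff (P i) j = 0" using deg[of i] ij(2) by (intro coeff_eq_0) simp
  ultimately have "lead_coeff (P j - P i) = 1" using deg by simp
  moreover have "ev (P j - P i) q = 0" using ev ij by (simp add: ev_simps)
  ultimately show ?thesis by (rule that)
qed

theorem digit_sums_close: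
  fixes q :: real
  assumes "1 < q" "q < 2" "\<not> pisot q" "e > 0"
  shows "\<exists>k. \<exists>x\<in>digit_sums q k. \<exists>y\<in>digit_sums q k. 0 < x - y \<and> x - y < e"
proof (rule ccontr)
  assume neg: "\<not> ?thesis"
  interpret separated_digit_sums q e
  proof
    fix x y k assume *: "x \<in> digit_sums q k" "y \<in> digit_sums q k" "x \<noteq> y"
    then show "e \<le> \<bar>x - y\<bar>" using neg by (cases "x < y") (force simp: not_less abs_if)+
  qed (use assms in auto)
  obtain f :: "int poly" where "lead_coeff f = 1" "ev f q = 0" by (rule algebraic_integer)
  then obtain p where p: "lead_coeff p = 1" "irreducible p" "ev p q = 0" by (rule monic_minimal_irreducible)
  have "ev p (complex_of_real q) = 0" by (simp add: ev_of_real p)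
  \<comment> \<open>As \<open>q\<close> is not Pisot, its irreducible monic equation has another
    root outside the open unit disc.\<close>
  then obtain z where zp: "ev p z = 0" "z \<noteq> complex_of_real q" "1 \<le> cmod z"
    using assms p unfolding pisot_def by (meson not_le)
  \<comment> \<open>Any polynomial representing \<open>t\<close> may be chosen;
    \<open>ev_eq_0_transfer\<close> makes the value at \<open>z\<close> independent of it.\<close>
  define \<sigma> where "\<sigma> t = ev (SOME g. ev g q = t) z" for t :: real
  have \<sigma>: "\<sigma> (ev g q) = ev g z" for g
  proof -
    define g' where "g' = (SOME g'. ev g' q = ev g q)"
    have "ev g' q = ev g q" unfolding g'_def by (rule someI[of _ g]) simp
    then have "ev (g' - g) q = 0" by (simp add: ev_simps)
    then have "ev (g' - g) z = 0" by (rule ev_eq_0_transfer[OF p(2,3) zp(1)])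
    then show ?thesis by (simp add: \<sigma>_def g'_def ev_simps)
  qed
  let ?R = "range (\<lambda>g. ev g q)"
  interpret conjugate_digit_sums q e ?R \<sigma> z
  proof
    have "\<sigma> (ev [:1:] q) = ev [:1:] z" by (rule \<sigma>)
    then show "\<sigma> 1 = 1" by (simp only: ev_const of_int_1)
    show "1 \<in> ?R" by (rule range_eqI[of _ _ "[:1:]"]) (simp add: ev_const)
    show "1 \<le> cmod z" by (rule zp)
    fix x y assume "x \<in> ?R" "y \<in> ?R"
    then obtain g h where gh: "x = ev g q" "y = ev h q" by auto
    have "\<sigma> (ev (g + h) q) = ev (g + h) z" "\<sigma> (ev (g - h) q) = ev (g - h) z" by (rule \<sigma>)+
    then show "\<sigma> (x + y) = \<sigma> x + \<sigma> y" "\<sigma> (x - y) = \<sigma> x - \<sigma> y" by (simp_all add: gh \<sigma> ev_simps)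
    show "x + y \<in> ?R" by (rule range_eqI[of _ _ "g + h"]) (simp add: gh ev_simps)
    show "x - y \<in> ?R" by (rule range_eqI[of _ _ "g - h"]) (simp add: gh ev_simps)
  next
    fix x assume "x \<in> ?R"
    then obtain g where g: "x = ev g q" by auto
    have "\<sigma> (ev (pCons 0 g) q) = ev (pCons 0 g) z" by (rule \<sigma>)
    then show "\<sigma> (q * x) = z * \<sigma> x" by (simp add: g \<sigma> ev_pCons)
    show "q * x \<in> ?R" by (rule range_eqI[of _ _ "pCons 0 g"]) (simp add: g ev_pCons)
  qed
  show False using conjugate_absurd zp(2) by blast
qed

section \<open>Homogeneous iterated function systems\<close>

lemma sum_lessThan_mult: "(\<Sum>j<a * b. g j) = (\<Sum>l<a. \<Sum>r<b. g (l * b + r))" for g :: "nat \<Rightarrow> 'a :: comm_monoid_add"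
proof -
  have "sum g {l * b..<l * b + b} = (\<Sum>r<b. g (l * b + r))" for l
    using sum.shift_bounds_nat_ivl[of g 0 "l * b" b] by (simp add: atLeast0LessThan add.commute)
  then show ?thesis by (simp add: sum.nat_group[symmetric])
qed

lemma power_dominates:
  fixes q :: real
  assumes "1 < q" "0 < a"
  shows "\<forall>\<^sub>F n in sequentially. C \<le> a * q ^ n"
proof -
  obtain m where "C / a < q ^ m" using real_arch_pow[OF assms(1)] by blast
  then have "C / a \<le> q ^ n" if "n \<ge> m" for n
    using power_increasing[OF that, of q] assms by linarith
  then show ?thesis
    using assms by (intro eventually_sequentiallyI[of m]) (simp add: field_simps)
qed

locale homogeneous_ifs =
  fixes p :: "nat \<Rightarrow> 'a :: euclidean_space" and n :: nat and lam :: real and S :: "nat \<Rightarrow> 'a \<Rightarrow> 'a"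
  assumes S_eq: "S i x = lam *\<^sub>R x + (1 - lam) *\<^sub>R p i" and lam: "0 < lam" "lam < 1"
begin

lemma foldr_diff: "foldr S w x - foldr S w y = lam ^ length w *\<^sub>R (x - y)"
proof (induction w)
  case (Cons i w)
  have "foldr S (i # w) x - foldr S (i # w) y = lam *\<^sub>R (foldr S w x - foldr S w y)"
    by (simp add: S_eq scaleR_diff_right)
  then show ?case by (simp add: Cons)
qed simp

lemma dist_foldr: "dist (foldr S w x) (foldr S w y) = lam ^ length w * dist x y"
  unfolding dist_norm foldr_diff using lam by simp

section \<open>Peeling off digits in barycentric coordinates\<close>

definition point :: "'a set \<Rightarrow> ('a \<Rightarrow> real) \<Rightarrow> 'a" where
  "point B u = (\<Sum>b\<in>B. u b *\<^sub>R b)"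

text \<open>Inverting the map with fixed point \<open>b\<close> in terms of weights:
  \<open>u\<close> is \<open>lam\<close> times \<open>u'\<close> plus \<open>1 - lam\<close> times
  the unit weight at \<open>b\<close>.\<close>

lemma point_step:
  assumes "finite B" "b \<in> B" "B \<subseteq> p ` {0..n}" "sum u B = 1"
    and u': "\<And>c. u' c = (u c - (1 - lam) * of_bool (c = b)) / lam"
  shows "sum u' B = 1" and "\<exists>i\<in>{0..n}. point B u = S i (point B u')"
proof -
  have "sum u' B = (sum u B - (1 - lam) * (\<Sum>c\<in>B. of_bool (c = b))) / lam"
    by (simp add: u' sum_divide_distrib[symmetric] sum_subtractf sum_distrib_left)
  also have "(\<Sum>c\<in>B. of_bool (c = b)) = (1 :: real)" using assms(1,2) by (simp add: of_bool_def)
  finally show "sum u' B = 1" using assms lam by simp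
  have u: "u c = lam * u' c + (1 - lam) * of_bool (c = b)" for c using lam by (simp add: u')
  obtain i where i: "i \<in> {0..n}" "p i = b" using assms by auto
  have "point B u = lam *\<^sub>R point B u' + (\<Sum>c\<in>B. ((1 - lam) * of_bool (c = b)) *\<^sub>R c)"
    by (simp add: point_def u scaleR_add_left sum.distrib scaleR_sum_right)
  also have "(\<Sum>c\<in>B. ((1 - lam) * of_bool (c = b)) *\<^sub>R c) = (\<Sum>c\<in>B. if c = b then (1 - lam) *\<^sub>R c else 0)"
    by (intro sum.cong) auto
  also have "\<dots> = (1 - lam) *\<^sub>R b" using assms(1,2) by simp
  finally show "\<exists>i\<in>{0..n}. point B u = S i (point B u')" using i by (intro bexI[of _ i]) (simp_all add: S_eq)
qed

text \<open>While some weight outside \<open>b0\<close> exceeds \<open>1 - lam\<close>, peel off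
  that vertex: all weights stay positive and that of \<open>b0\<close> grows by the factor
  \<open>1 / lam\<close>. It remains below 1, so the process ends; \<open>N\<close> bounds the
  number of steps.\<close>

lemma reach_small_weights:
  assumes B: "finite B" "B \<subseteq> p ` {0..n}" "b0 \<in> B" "B \<noteq> {b0}"
    and u: "\<And>b. b \<in> B \<Longrightarrow> 0 < u b" "sum u B = 1"
  shows "\<exists>w\<in>lists {0..n}. \<exists>u'. (\<forall>b\<in>B. 0 < u' b) \<and> sum u' B = 1 \<and> (\<forall>b\<in>B - {b0}. u' b \<le> 1 - lam) \<and>
           point B u = foldr S w (point B u')"
proof -
  obtain N where "1 / u b0 < (1 / lam) ^ N" using real_arch_pow[of "1 / lam"] lam by auto
  then have "lam ^ N \<le> u b0" using u(1)[OF B(3)] lam by (simp add: field_simps)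
  then show ?thesis using u
  proof (induction N arbitrary: u)
    case 0
    obtain b where b: "b \<in> B" "b \<noteq> b0" using B by blast
    have "sum u B = u b0 + sum u (B - {b0})" using B by (simp add: sum.remove)
    moreover have "0 < sum u (B - {b0})" using B b 0 by (intro sum_pos) auto
    ultimately show ?case using 0 by simp
  next
    case (Suc N)
    show ?case
    proof (cases "\<forall>b\<in>B - {b0}. u b \<le> 1 - lam")
      case True
      then show ?thesis using Suc.prems by (intro bexI[of _ "[]"] exI[of _ u]) auto
    next
      case False
      then obtain b where b: "b \<in> B" "b \<noteq> b0" "1 - lam < u b" by force
      define u' where "u' c = (u c - (1 - lam) * of_bool (c = b)) / lam" for c
      note step = point_step[OF B(1) b(1) B(2) Suc.prems(3) u'_def]
      obtain i where i: "i \<in> {0..n}" "point B u = S i (point B u')" using step(2) by blast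
      have "lam ^ N \<le> u' b0" using Suc.prems(1) b lam by (simp add: u'_def field_simps)
      moreover have "0 < u' c" if "c \<in> B" for c
        using Suc.prems(2)[OF that] b lam by (simp add: u'_def)
      ultimately obtain w u'' where w: "w \<in> lists {0..n}" "\<forall>b\<in>B. 0 < u'' b" "sum u'' B = 1"
        "\<forall>b\<in>B - {b0}. u'' b \<le> 1 - lam" "point B u' = foldr S w (point B u'')"
        using Suc.IH[of u'] step(1) by blast
      then show ?thesis using i by (intro bexI[of _ "i # w"] exI[of _ u'']) auto
    qed
  qed
qed

text \<open>Iterated \<open>point_step\<close>: what is subtracted from each coordinate is a
  multiple of a sum of distinct powers of \<open>1 / lam\<close>, which is how digit sums
  enter.\<close>

lemma reach_digits:
  assumes B: "finite B" "B \<subseteq> p ` {0..n}" and D: "\<And>m. D m \<in> B" and u: "sum u B = 1"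
  shows "\<exists>w\<in>lists {0..n}. \<exists>u'. sum u' B = 1 \<and> point B u = foldr S w (point B u') \<and>
    (\<forall>b. u' b = (1 / lam) ^ k * u b - (1 / lam - 1) * (\<Sum>m<k. (1 / lam) ^ (k - Suc m) * of_bool (b = D m)))"
proof (induction k)
  case 0
  show ?case by (intro bexI[of _ "[]"] exI[of _ u]) (use u in auto)
next
  case (Suc k)
  then obtain w u' where w: "w \<in> lists {0..n}" "sum u' B = 1" "point B u = foldr S w (point B u')"
    "\<And>b. u' b = (1 / lam) ^ k * u b - (1 / lam - 1) * (\<Sum>m<k. (1 / lam) ^ (k - Suc m) * of_bool (b = D m))"
    by blast
  define u'' where "u'' c = (u' c - (1 - lam) * of_bool (c = D k)) / lam" for c
  note step = point_step[OF B(1) D[of k] B(2) w(2) u''_def]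
  obtain i where i: "i \<in> {0..n}" "point B u' = S i (point B u'')" using step(2) by blast
  have pw: "(1 / lam) ^ (k - m) = (1 / lam) * (1 / lam) ^ (k - Suc m)" if "m < k" for m
    using that by (metis Suc_diff_Suc power_Suc)
  have "u'' b = (1 / lam) ^ Suc k * u b - (1 / lam - 1) * (\<Sum>m<Suc k. (1 / lam) ^ (Suc k - Suc m) * of_bool (b = D m))" for b
  proof -
    have "(\<Sum>m<Suc k. (1 / lam) ^ (Suc k - Suc m) * of_bool (b = D m)) =
        (\<Sum>m<k. (1 / lam) ^ (k - m) * of_bool (b = D m)) + of_bool (b = D k)"
      by (simp del: sum_mult_of_bool_eq)
    also have "(\<Sum>m<k. (1 / lam) ^ (k - m) * of_bool (b = D m)) =
        (\<Sum>m<k. (1 / lam) * ((1 / lam) ^ (k - Suc m) * of_bool (b = D m)))"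
      by (intro sum.cong refl) (simp only: pw lessThan_iff mult.assoc)
    finally have "(\<Sum>m<Suc k. (1 / lam) ^ (Suc k - Suc m) * of_bool (b = D m)) =
        (1 / lam) * (\<Sum>m<k. (1 / lam) ^ (k - Suc m) * of_bool (b = D m)) + of_bool (b = D k)"
      by (simp only: sum_distrib_left)
    then show ?thesis using lam by (simp add: u''_def w(4) field_simps)
  qed
  moreover have "point B u = foldr S (w @ [i]) (point B u'')" "w @ [i] \<in> lists {0..n}"
    using i w(1,3) by simp_all
  ultimately show ?case using step(1) by blast
qed

lemma reach_target_weights:
  fixes d :: nat and f :: "nat \<Rightarrow> 'a" and t u :: "'a \<Rightarrow> real"
  defines "q \<equiv> 1 / lam ^ (2 * d)"
  assumes q: "1 < q" "q < 2"
    and close: "\<And>e. e > 0 \<Longrightarrow> \<exists>k. \<exists>x\<in>digit_sums q k. \<exists>y\<in>digit_sums q k. 0 < x - y \<and> x - y < e"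
    and B: "finite B" "B \<subseteq> p ` {0..n}" "b0 \<in> B" and f: "bij_betw f {..<d} (B - {b0})"
    and u: "sum u B = 1" "\<And>b. b \<in> B - {b0} \<Longrightarrow> 0 < u b" "\<And>b. b \<in> B - {b0} \<Longrightarrow> u b \<le> 1 - lam"
    and e: "0 < e"
  shows "\<exists>w\<in>lists {0..n}. \<exists>u'. sum u' B = 1 \<and> point B u = foldr S w (point B u') \<and>
           (\<forall>b\<in>B - {b0}. \<bar>u' b - t b\<bar> \<le> e)"
proof -
  define \<beta> where "\<beta> = 1 / lam"
  have \<beta>: "1 < \<beta>" using lam by (simp add: \<beta>_def)
  have q\<beta>: "q = \<beta> ^ (2 * d)" by (simp add: q_def \<beta>_def power_one_over)
  define M where "M i = (\<beta> - 1) * \<beta> ^ (2 * i)" for i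
  have M: "0 < M i" for i using \<beta> by (simp add: M_def)
  define e' where "e' = e / M d"
  have e': "0 < e'" using e M by (simp add: e'_def)
  obtain s n0 where sn: "\<And>N y. n0 \<le> N \<Longrightarrow> s \<le> y \<Longrightarrow> y \<le> \<beta> * ((q ^ N - 1) / (q - 1)) \<Longrightarrow>
      \<exists>a\<in>digit_sums q N. \<exists>a'\<in>digit_sums q N. \<bar>y - (a + \<beta> * a')\<bar> \<le> e'"
    using two_scale_dense[OF q close e', of \<beta>] \<beta> by fastforce
  define Y where "Y N i = (q ^ N * u (f i) - t (f i)) / M i" for N i
  have fB: "f i \<in> B - {b0}" if "i < d" for i using f that by (auto simp: bij_betw_def)
  have "\<forall>\<^sub>F N in sequentially. \<forall>i\<in>{..<d}. s \<le> Y N i \<and> Y N i \<le> \<beta> * ((q ^ N - 1) / (q - 1))"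
  proof (rule eventually_ball_finite, simp, rule ballI)
    fix i assume "i \<in> {..<d}"
    then have i: "f i \<in> B - {b0}" using fB by simp
    have c: "1 / (q - 1) > 1" using q by simp
    have "1 * 1 < \<beta> * (1 / (q - 1))" using \<beta> c by (intro mult_strict_mono) auto
    \<comment> \<open>Comparison of coefficients of \<open>q ^ N\<close>: weights of at most
      \<open>1 - lam\<close> give at most \<open>lam\<close> in \<open>Y N i\<close>, while the
      approximable range has \<open>\<beta> / (q - 1) > 1\<close>, which leaves room for large
      \<open>N\<close>.\<close>
    then have "0 < \<beta> * (1 / (q - 1)) - lam" using lam by linarith
    then have "\<forall>\<^sub>F N in sequentially. \<beta> * (1 / (q - 1)) + \<bar>t (f i)\<bar> / (\<beta> - 1) \<le> (\<beta> * (1 / (q - 1)) - lam) * q ^ N"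
      by (rule power_dominates[OF q(1)])
    moreover have "\<forall>\<^sub>F N in sequentially. s * M i + t (f i) \<le> u (f i) * q ^ N"
      by (rule power_dominates[OF q(1) u(2)[OF i]])
    ultimately show "\<forall>\<^sub>F N in sequentially. s \<le> Y N i \<and> Y N i \<le> \<beta> * ((q ^ N - 1) / (q - 1))"
    proof eventually_elim
      case (elim N)
      have "s \<le> Y N i" using elim(2) M[of i] by (simp add: Y_def pos_le_divide_eq mult.commute)
      moreover have "Y N i \<le> \<beta> * ((q ^ N - 1) / (q - 1))"
      proof -
        have "q ^ N * u (f i) \<le> q ^ N * (1 - lam)" using u(3)[OF i] q by (intro mult_left_mono) auto
        then have "q ^ N * u (f i) - t (f i) \<le> q ^ N * (1 - lam) + \<bar>t (f i)\<bar>" by linarith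
        then have "Y N i \<le> (q ^ N * (1 - lam) + \<bar>t (f i)\<bar>) / M i"
          unfolding Y_def using M[of i] by (intro divide_right_mono) auto
        also have "\<dots> \<le> (q ^ N * (1 - lam) + \<bar>t (f i)\<bar>) / (\<beta> - 1)"
        proof (rule divide_left_mono)
          show "\<beta> - 1 \<le> M i" using \<beta> one_le_power[of \<beta> "2 * i"] by (simp add: M_def)
          show "0 \<le> q ^ N * (1 - lam) + \<bar>t (f i)\<bar>" using q lam by simp
          show "0 < M i * (\<beta> - 1)" using \<beta> M[of i] by simp
        qed
        also have "\<dots> = lam * q ^ N + \<bar>t (f i)\<bar> / (\<beta> - 1)"
        proof -
          have "(1 - lam) / (\<beta> - 1) = lam" using lam by (simp add: \<beta>_def field_simps)
          then have "q ^ N * (1 - lam) / (\<beta> - 1) = q ^ N * lam" by (metis times_divide_eq_right)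
          then show ?thesis by (simp add: add_divide_distrib mult.commute)
        qed
        also have "\<dots> \<le> \<beta> * (1 / (q - 1)) * q ^ N - \<beta> * (1 / (q - 1))"
          using elim(1) by (simp add: left_diff_distrib)
        also have "\<dots> = \<beta> * ((q ^ N - 1) / (q - 1))"
          by (simp add: diff_divide_distrib right_diff_distrib)
        finally show ?thesis .
      qed
      ultimately show ?case by simp
    qed
  qed
  then have "\<forall>\<^sub>F N in sequentially. (\<forall>i\<in>{..<d}. s \<le> Y N i \<and> Y N i \<le> \<beta> * ((q ^ N - 1) / (q - 1))) \<and> n0 \<le> N"
    by (intro eventually_conj eventually_ge_at_top)
  then obtain N where N: "n0 \<le> N" "\<And>i. i < d \<Longrightarrow> s \<le> Y N i \<and> Y N i \<le> \<beta> * ((q ^ N - 1) / (q - 1))"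
    by (auto dest!: eventually_happens)
  have "\<exists>c :: nat \<Rightarrow> nat \<Rightarrow> bool. \<bar>Y N i - ((\<Sum>l<N. of_bool (c 0 l) * q ^ l) + \<beta> * (\<Sum>l<N. of_bool (c 1 l) * q ^ l))\<bar> \<le> e'"
    if i: "i < d" for i
  proof -
    obtain a a' where a: "a \<in> digit_sums q N" "a' \<in> digit_sums q N" "\<bar>Y N i - (a + \<beta> * a')\<bar> \<le> e'"
      using sn[OF N(1)] N(2)[OF i] by blast
    obtain x where x: "\<And>i. x i \<in> {0, 1}" "a = (\<Sum>i<N. x i * q ^ i)" using digit_sums_bits[OF a(1)] by blast
    obtain x' where x': "\<And>i. x' i \<in> {0, 1}" "a' = (\<Sum>i<N. x' i * q ^ i)" using digit_sums_bits[OF a(2)] by blast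
    have "x l = of_bool (x l = 1)" "x' l = of_bool (x' l = 1)" for l using x(1)[of l] x'(1)[of l] by auto
    then have "a = (\<Sum>l<N. of_bool (x l = 1) * q ^ l)" "a' = (\<Sum>l<N. of_bool (x' l = 1) * q ^ l)"
      using x(2) x'(2) by auto
    then show ?thesis using a(3) by (intro exI[of _ "\<lambda>e l. if e = 0 then x l = 1 else x' l = 1"]) simp
  qed
  then obtain c :: "nat \<Rightarrow> nat \<Rightarrow> nat \<Rightarrow> bool" where c: "\<And>i. i < d \<Longrightarrow>
      \<bar>Y N i - ((\<Sum>l<N. of_bool (c i 0 l) * q ^ l) + \<beta> * (\<Sum>l<N. of_bool (c i 1 l) * q ^ l))\<bar> \<le> e'"
    by metis
  \<comment> \<open>Position \<open>l * (d * 2) + (i * 2 + e)\<close> carries the binary digit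
    \<open>c i e l\<close> of vertex \<open>f i\<close>. The test \<open>d > 0\<close> guards the
    case without residue classes.\<close>
  define E where "E j = (let l = j div (d * 2); r = j mod (d * 2) in
      if d > 0 \<and> c (r div 2) (r mod 2) l then f (r div 2) else b0)" for j
  have E: "E (l * (d * 2) + (i * 2 + e)) = (if c i e l then f i else b0)" if "i < d" "e < 2" for l i e
  proof -
    have "i * 2 + e < d * 2" using that by linarith
    then have "(l * (d * 2) + (i * 2 + e)) div (d * 2) = l" "(l * (d * 2) + (i * 2 + e)) mod (d * 2) = i * 2 + e"
      by (simp_all add: div_nat_eqI)
    then show ?thesis using that by (simp add: E_def Let_def)
  qed
  have EB: "E j \<in> B" for j
  proof (cases "d > 0")
    case True
    then have "j mod (d * 2) div 2 < d" by (simp add: less_mult_imp_div_less)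
    then show ?thesis using fB B by (auto simp: E_def Let_def)
  qed (use B in \<open>simp add: E_def\<close>)
  define k where "k = N * (d * 2)"
  \<comment> \<open>Reversed order: the digit peeled off first receives the highest power of
    \<open>1 / lam\<close>.\<close>
  obtain w u' where w: "w \<in> lists {0..n}" "sum u' B = 1" "point B u = foldr S w (point B u')"
    "\<And>b. u' b = (1 / lam) ^ k * u b - (1 / lam - 1) * (\<Sum>m<k. (1 / lam) ^ (k - Suc m) * of_bool (b = E (k - Suc m)))"
    using reach_digits[OF B(1,2), of "\<lambda>m. E (k - Suc m)" u k] EB u(1) by blast
  have "\<bar>u' (f i) - t (f i)\<bar> \<le> e" if i: "i < d" for i
  proof -
    let ?Z = "(\<Sum>l<N. of_bool (c i 0 l) * q ^ l) + \<beta> * (\<Sum>l<N. of_bool (c i 1 l) * q ^ l)"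
    have \<beta>k: "\<beta> ^ (l * (d * 2)) = q ^ l" for l
      unfolding q\<beta> power_mult[symmetric] by (simp add: mult_ac)
    have two: "(\<Sum>e<2. h e) = h 0 + h 1" for h :: "nat \<Rightarrow> real" by (simp add: numeral_2_eq_2)
    have pe: "\<beta> ^ (l * (d * 2) + (i * 2 + e)) = q ^ l * \<beta> ^ (2 * i) * \<beta> ^ e" for l e
      by (simp only: power_add \<beta>k mult.commute[of i 2] mult.assoc)
    have eq: "(f i = E (l * (d * 2) + (i' * 2 + e))) = (i' = i \<and> c i e l)" if "i' < d" "e < 2" for l i' e
      using E[OF that] fB[OF i] f i that(1) by (auto simp: bij_betw_def inj_on_def)
    have "(\<Sum>m<k. \<beta> ^ (k - Suc m) * of_bool (f i = E (k - Suc m))) = (\<Sum>j<k. \<beta> ^ j * of_bool (f i = E j))"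
      by (rule sum.nat_diff_reindex)
    also have "\<dots> = (\<Sum>l<N. \<Sum>i'<d. \<Sum>e<2. \<beta> ^ (l * (d * 2) + (i' * 2 + e)) * of_bool (f i = E (l * (d * 2) + (i' * 2 + e))))"
      by (simp add: k_def sum_lessThan_mult)
    also have "\<dots> = (\<Sum>l<N. \<Sum>i'<d. \<Sum>e<2. if i' = i then \<beta> ^ (l * (d * 2) + (i' * 2 + e)) * of_bool (c i e l) else 0)"
      by (intro sum.cong refl) (auto simp: eq)
    also have "\<dots> = (\<Sum>l<N. \<Sum>i'<d. if i' = i then (\<Sum>e<2. \<beta> ^ (l * (d * 2) + (i' * 2 + e)) * of_bool (c i e l)) else 0)"
      by (intro sum.cong refl) auto
    also have "\<dots> = (\<Sum>l<N. \<Sum>e<2. \<beta> ^ (l * (d * 2) + (i * 2 + e)) * of_bool (c i e l))"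
      using i by simp
    also have "\<dots> = (\<Sum>l<N. q ^ l * \<beta> ^ (2 * i) * of_bool (c i 0 l) + q ^ l * \<beta> ^ (2 * i) * \<beta> * of_bool (c i 1 l))"
      by (simp only: two pe power_0 power_one_right mult_1_right)
    also have "\<dots> = \<beta> ^ (2 * i) * ?Z"
      by (simp add: sum.distrib sum_distrib_left distrib_left mult_ac del: sum_mult_of_bool_eq sum_of_bool_mult_eq)
    finally have "u' (f i) = q ^ N * u (f i) - M i * ?Z"
      unfolding w(4) \<beta>_def[symmetric] using \<beta>k[of N] by (simp add: k_def M_def mult.assoc)
    moreover have "M i * Y N i = q ^ N * u (f i) - t (f i)" using M[of i] by (simp add: Y_def)
    ultimately have "u' (f i) - t (f i) = M i * (Y N i - ?Z)" by (simp only: right_diff_distrib)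
    then have "\<bar>u' (f i) - t (f i)\<bar> = M i * \<bar>Y N i - ?Z\<bar>" using M[of i] by (simp add: abs_mult)
    also have "\<dots> \<le> M i * e'" using c[OF i] M[of i] by (intro mult_left_mono) auto
    also have "\<dots> \<le> M d * e'"
      using e' i \<beta> by (intro mult_right_mono) (auto simp: M_def intro!: mult_left_mono power_increasing)
    also have "\<dots> = e" using M[of d] by (simp add: e'_def)
    finally show ?thesis .
  qed
  then have "\<forall>b\<in>B - {b0}. \<bar>u' b - t b\<bar> \<le> e" using f by (auto simp: bij_betw_def) (metis DiffI imageE lessThan_iff singletonD)
  then show ?thesis using w(1,2,3) by blast
qed

end

section \<open>The attractor and the coding map\<close>

lemma seq_comp_foldr: "seq_comp S a j y = foldr S (map a [0..<j]) y"
  by (induction j arbitrary: y) auto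

locale ifs_attractor = homogeneous_ifs +
  fixes X
  assumes X_compact: "compact X" and X_ne: "X \<noteq> {}" and X_eq: "X = (\<Union>i\<in>{0..n}. S i ` X)"
begin

lemma foldr_X: "w \<in> lists {0..n} \<Longrightarrow> x \<in> X \<Longrightarrow> foldr S w x \<in> X"
proof (induction w)
  case (Cons i w)
  then have "S i (foldr S w x) \<in> (\<Union>i\<in>{0..n}. S i ` X)" by auto
  then show ?case using X_eq by simp
qed simp

lemma open_S: "open U \<Longrightarrow> open (S i ` U)"
proof -
  assume "open U"
  have "S i = (\<lambda>x. (1 - lam) *\<^sub>R p i + lam *\<^sub>R x)" by (auto simp: S_eq)
  then show ?thesis using open_affinity[OF \<open>open U\<close>, of lam "(1 - lam) *\<^sub>R p i"] lam by simp
qed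

lemma S_interior: "i \<in> {0..n} \<Longrightarrow> x \<in> interior X \<Longrightarrow> S i x \<in> interior X"
proof -
  assume i: "i \<in> {0..n}" and x: "x \<in> interior X"
  have "S i ` interior X \<subseteq> X"
    using foldr_X[of "[i]"] i interior_subset by auto
  then have "S i ` interior X \<subseteq> interior X" by (intro interior_maximal open_S open_interior)
  then show ?thesis using x by auto
qed

lemma foldr_interior: "w \<in> lists {0..n} \<Longrightarrow> x \<in> interior X \<Longrightarrow> foldr S w x \<in> interior X"
  by (induction w) (auto intro: S_interior)

lemma open_foldr: "open U \<Longrightarrow> open (foldr S w ` U)"
proof (induction w)
  case (Cons i w)
  then have "open (S i ` foldr S w ` U)" by (intro open_S) auto
  then show ?case by (simp add: image_image)
qed simp

lemma compact_foldr: "compact U \<Longrightarrow> compact (foldr S w ` U)"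
proof (induction w)
  case (Cons i w)
  have "S i = (\<lambda>x. (1 - lam) *\<^sub>R p i + lam *\<^sub>R x)" by (auto simp: S_eq)
  then have "compact (S i ` foldr S w ` U)"
    using compact_affinity[OF Cons.IH[OF Cons.prems], of "(1 - lam) *\<^sub>R p i" lam] by simp
  then show ?case by (simp add: image_image)
qed simp

lemma X_prefix: "x \<in> X \<Longrightarrow> \<exists>w\<in>lists {0..n}. length w = j \<and> (\<exists>y\<in>X. x = foldr S w y)"
proof (induction j)
  case (Suc j)
  then obtain w y where w: "w \<in> lists {0..n}" "length w = j" "y \<in> X" "x = foldr S w y" by blast
  obtain i y' where "i \<in> {0..n}" "y' \<in> X" "y = S i y'" using w(3) X_eq by blast
  then show ?case using w by (intro bexI[of _ "w @ [i]"]) auto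
qed (auto intro!: bexI[of _ "[]"])

text \<open>Replacing the tail \<open>y \<in> X\<close> by 0 moves the point by
  \<open>lam ^ j * norm y\<close>, and \<open>X\<close> is bounded.\<close>

lemma coding_eqI:
  assumes "\<And>j. \<exists>y\<in>X. x = foldr S (map a [0..<j]) y"
  shows "coding S a = x"
proof -
  obtain M where M: "\<And>y. y \<in> X \<Longrightarrow> norm y \<le> M"
    using compact_imp_bounded[OF X_compact] unfolding bounded_iff by blast
  have bound: "dist (seq_comp S a j 0) x \<le> M * lam ^ j" for j
  proof -
    obtain y where y: "y \<in> X" "x = foldr S (map a [0..<j]) y" using assms by blast
    have "dist (seq_comp S a j 0) x = lam ^ j * norm y"
      unfolding seq_comp_foldr y(2) dist_foldr by simp
    also have "\<dots> \<le> M * lam ^ j" using M[OF y(1)] lam by (simp add: mult.commute)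
    finally show ?thesis .
  qed
  have "(\<lambda>j. M * lam ^ j) \<longlonglongrightarrow> 0"
    using lam by (intro tendsto_mult_right_zero LIMSEQ_power_zero) auto
  then have "(\<lambda>j. dist (seq_comp S a j 0) x) \<longlonglongrightarrow> 0"
    by (rule Lim_null_comparison[rotated]) (simp add: bound)
  then have "(\<lambda>j. seq_comp S a j 0) \<longlonglongrightarrow> x" by (rule tendsto_dist_iff[THEN iffD2])
  then show ?thesis by (simp add: coding_def limI)
qed

text \<open>The nested compact images of \<open>X\<close> under the prefixes of \<open>a\<close>
  have a common point, which \<open>coding_eqI\<close> identifies with the limit.\<close>

lemma coding_prefix:
  assumes a: "\<And>k. a k \<in> {0..n}"
  shows "\<exists>y\<in>X. coding S a = foldr S (map a [0..<j]) y"
proof -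
  define K where "K j = foldr S (map a [0..<j]) ` X" for j
  have "\<Inter>(range K) \<noteq> {}"
  proof (rule compact_nest)
    show "compact (K j)" for j
      unfolding K_def by (rule compact_foldr[OF X_compact])
    show "K j \<noteq> {}" for j using X_ne by (simp add: K_def)
    have "K (Suc j) \<subseteq> K j" for j
      using foldr_X[of "[a j]"] a by (auto simp: K_def)
    then show "K m \<subseteq> K l" if "l \<le> m" for l m by (rule lift_Suc_antimono_le) (rule that)
  qed
  then obtain x where "\<And>j. x \<in> K j" by blast
  then have x: "\<And>j. \<exists>y\<in>X. x = foldr S (map a [0..<j]) y" by (auto simp: K_def)
  then show ?thesis using coding_eqI[OF x] by simp
qed

text \<open>A long enough word \<open>w\<close> coding an interior point maps all of
  \<open>X\<close> into the interior. A universal sequence contains \<open>w\<close>, and the digits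
  preceding it act by maps preserving the interior.\<close>

lemma X_uni_subset:
  assumes "interior X \<noteq> {}"
  shows "X_uni {0..n} S X \<subseteq> interior X"
proof
  fix x assume "x \<in> X_uni {0..n} S X"
  then obtain a where a: "\<And>k. a k \<in> {0..n}" "universal {0..n} a" "coding S a = x"
    by (auto simp: X_uni_def)
  obtain y e where y: "y \<in> interior X" "0 < e" "ball y e \<subseteq> interior X"
    using assms open_interior open_contains_ball by (metis all_not_in_conv)
  have yX: "y \<in> X" using y interior_subset by auto
  obtain M0 where M0: "\<And>x. x \<in> X \<Longrightarrow> dist y x \<le> M0"
    using bounded_any_center[of X y] compact_imp_bounded[OF X_compact] by blast
  define M where "M = max 1 M0"
  have M: "0 < M" "\<And>x. x \<in> X \<Longrightarrow> dist x y \<le> M"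
    using M0 by (auto simp: M_def dist_commute le_max_iff_disj)
  have "\<exists>j. lam ^ j < e / (2 * M)" using y(2) M(1) lam by (intro real_arch_pow_inv) auto
  then obtain j where j: "lam ^ j < e / (2 * M)" by blast
  obtain w z where w: "w \<in> lists {0..n}" "length w = j" "z \<in> X" "y = foldr S w z" using X_prefix[OF yX] by blast
  have int: "foldr S w z' \<in> interior X" if "z' \<in> X" for z'
  proof -
    have "dist z z' \<le> 2 * M" using M(2)[OF w(3)] M(2)[OF that] dist_triangle2[of z z' y] by linarith
    then have "lam ^ j * dist z z' \<le> lam ^ j * (2 * M)" using lam by (intro mult_left_mono) auto
    also have "\<dots> < e" using j M(1) by (simp add: pos_less_divide_eq)
    finally have "dist y (foldr S w z') < e" unfolding w(4) dist_foldr w(2) .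
    then show ?thesis using y(3) by auto
  qed
  obtain k where k: "\<And>m. m < length w \<Longrightarrow> a (k + m) = w ! m" using a(2) w(1) unfolding universal_def by blast
  have "map a [k..<k + length w] = w" using k by (intro nth_equalityI) auto
  then have split: "map a [0..<k + length w] = map a [0..<k] @ w"
    using upt_add_eq_append[of 0 k "length w"] by simp
  have "\<exists>z'\<in>X. x = foldr S (map a [0..<k + length w]) z'"
    unfolding a(3)[symmetric] by (rule coding_prefix[OF a(1)])
  then obtain z' where z': "z' \<in> X" "x = foldr S (map a [0..<k + length w]) z'" by blast
  have "foldr S (map a [0..<k]) (foldr S w z') \<in> interior X"
    using a(1) by (intro foldr_interior int z'(1)) auto
  then show "x \<in> interior X" unfolding z'(2) split by simp
qed

text \<open>Pigeonhole: some weight is at least \<open>1 - lam\<close>, and peeling off its vertex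
  leaves non-negative weights. After \<open>j\<close> rounds \<open>x\<close> is within a multiple
  of \<open>lam ^ j\<close> of the closed set \<open>X\<close>.\<close>

lemma convex_hull_subset_X:
  assumes B: "finite B" "B \<subseteq> p ` {0..n}" "B \<noteq> {}" and c: "(1 - lam) * real (card B) \<le> 1"
  shows "convex hull B \<subseteq> X"
proof
  fix x assume "x \<in> convex hull B"
  then obtain u where u: "\<forall>b\<in>B. 0 \<le> u b" "sum u B = 1" "x = point B u"
    using B by (auto simp: convex_hull_finite point_def)
  have pre: "\<exists>w\<in>lists {0..n}. length w = j \<and> (\<exists>u'. (\<forall>b\<in>B. 0 \<le> u' b) \<and> sum u' B = 1 \<and> x = foldr S w (point B u'))" for j
  proof (induction j)
    case 0
    then show ?case using u by (intro bexI[of _ "[]"]) auto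
  next
    case (Suc j)
    then obtain w u' where w: "w \<in> lists {0..n}" "length w = j" "\<forall>b\<in>B. 0 \<le> u' b" "sum u' B = 1"
      "x = foldr S w (point B u')" by blast
    have "\<exists>b\<in>B. 1 - lam \<le> u' b"
    proof (rule ccontr)
      assume "\<not> ?thesis"
      then have "sum u' B < (\<Sum>b\<in>B. 1 - lam)" using B by (intro sum_strict_mono) auto
      then show False using w(4) c by (simp add: mult.commute)
    qed
    then obtain b where b: "b \<in> B" "1 - lam \<le> u' b" by blast
    define u'' where "u'' c = (u' c - (1 - lam) * of_bool (c = b)) / lam" for c
    note step = point_step[OF B(1) b(1) B(2) w(4) u''_def]
    obtain i where i: "i \<in> {0..n}" "point B u' = S i (point B u'')" using step(2) by blast
    have "\<forall>c\<in>B. 0 \<le> u'' c" using w(3) b lam by (auto simp: u''_def)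
    then show ?case using w i step(1) by (intro bexI[of _ "w @ [i]"]) auto
  qed
  obtain x0 where x0: "x0 \<in> X" using X_ne by blast
  obtain M where M: "\<And>y. y \<in> convex hull B \<Longrightarrow> dist x0 y \<le> M"
    using compact_convex_hull[OF finite_imp_compact[OF B(1)]] compact_imp_bounded bounded_any_center[of _ x0] by metis
  show "x \<in> X"
  proof (rule ccontr)
    assume "x \<notin> X"
    then obtain e where e: "0 < e" "\<And>y. y \<in> X \<Longrightarrow> e \<le> dist x y"
      using separate_point_closed[of X x] compact_imp_closed[OF X_compact] by blast
    have "(\<lambda>j. lam ^ j * M) \<longlonglongrightarrow> 0" using lam by (intro tendsto_mult_left_zero LIMSEQ_power_zero) auto
    then have "\<forall>\<^sub>F j in sequentially. lam ^ j * M < e" using e(1) by (rule order_tendstoD)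
    then obtain j where j: "lam ^ j * M < e" by (auto dest!: eventually_happens)
    obtain w u' where w: "w \<in> lists {0..n}" "length w = j" "\<forall>b\<in>B. 0 \<le> u' b" "sum u' B = 1"
      "x = foldr S w (point B u')" using pre by blast
    have "point B u' \<in> convex hull B" using w B by (auto simp: convex_hull_finite point_def)
    then have "dist (point B u') x0 \<le> M" using M by (metis dist_commute)
    then have "dist x (foldr S w x0) \<le> lam ^ j * M"
      unfolding w(5) dist_foldr w(2) using lam by (intro mult_left_mono) auto
    then show False using e(2)[OF foldr_X[OF w(1) x0]] j by linarith
  qed
qed

end

section \<open>Reaching open sets and building universal codings\<close>

text \<open>Weights of \<open>x\<close> in the open simplex are positive; those of a target
  \<open>y\<close> in \<open>U\<close> may have any sign. First the weights outside
  \<open>b0\<close> are made small, then they are steered close to those of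
  \<open>y\<close>.\<close>

lemma (in homogeneous_ifs) reach_open:
  fixes B :: "'a set"
  defines "q \<equiv> 1 / lam ^ (2 * DIM('a))"
  assumes q: "1 < q" "q < 2"
    and close: "\<And>e. e > 0 \<Longrightarrow> \<exists>k. \<exists>x\<in>digit_sums q k. \<exists>y\<in>digit_sums q k. 0 < x - y \<and> x - y < e"
    and B: "B \<subseteq> p ` {0..n}" "card B = DIM('a) + 1" "aff_dim B = int DIM('a)"
    and x: "x \<in> interior (convex hull B)" and U: "open U" "U \<noteq> {}"
  shows "\<exists>w\<in>lists {0..n}. \<exists>y\<in>U. x = foldr S w y"
proof -
  have fin: "finite B" using B(1) finite_subset by blast
  have ind: "\<not> affine_dependent B" using B(2,3) fin by (simp add: affine_independent_iff_card)
  obtain u where u: "\<And>b. b \<in> B \<Longrightarrow> 0 < u b" "sum u B = 1" "x = point B u"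
    using x B(2) interior_convex_hull_explicit_minimal[OF ind] by (auto simp: point_def)
  obtain y e where y: "y \<in> U" "0 < e" "ball y e \<subseteq> U" using U open_contains_ball by (metis all_not_in_conv)
  have "y \<in> affine hull B" using B(3) aff_dim_eq_full by blast
  then obtain t where t: "sum t B = 1" "y = point B t" using fin by (auto simp: affine_hull_finite point_def)
  obtain b0 where b0: "b0 \<in> B" using B(2) by fastforce
  have "card (B - {b0}) = DIM('a)" using B(2) b0 by simp
  then obtain f where f: "bij_betw f {..<DIM('a)} (B - {b0})"
    using ex_bij_betw_nat_finite[of "B - {b0}"] fin by (auto simp: atLeast0LessThan)
  have "B \<noteq> {b0}" using B(2) by auto
  then obtain w1 u1 where w1: "w1 \<in> lists {0..n}" "\<forall>b\<in>B. 0 < u1 b" "sum u1 B = 1"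
    "\<forall>b\<in>B - {b0}. u1 b \<le> 1 - lam" "x = foldr S w1 (point B u1)"
    using reach_small_weights[OF fin B(1) b0 _ u(1,2)] u(3) by auto
  define E where "E = e / (1 + (\<Sum>b\<in>B - {b0}. norm (b - b0)))"
  have den: "0 < 1 + (\<Sum>b\<in>B - {b0}. norm (b - b0))" by (simp add: add_pos_nonneg sum_nonneg)
  have E: "0 < E" using y den by (simp add: E_def)
  obtain w2 u2 where w2: "w2 \<in> lists {0..n}" "sum u2 B = 1" "point B u1 = foldr S w2 (point B u2)"
    "\<forall>b\<in>B - {b0}. \<bar>u2 b - t b\<bar> \<le> E"
    using reach_target_weights[OF q[unfolded q_def] close[unfolded q_def] fin B(1) b0 f w1(3) _ _ E, of t] w1(2,4) by auto
  \<comment> \<open>The subtracted term is 0, since both weight systems have sum 1; it removes the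
    uncontrolled weight of \<open>b0\<close> from the estimate.\<close>
  have "point B u2 - y = (\<Sum>b\<in>B. (u2 b - t b) *\<^sub>R b) - (\<Sum>b\<in>B. (u2 b - t b)) *\<^sub>R b0"
    using w2(2) t by (simp add: point_def sum_subtractf scaleR_diff_left)
  also have "\<dots> = (\<Sum>b\<in>B. (u2 b - t b) *\<^sub>R (b - b0))"
    by (simp only: scaleR_diff_right scaleR_sum_left sum_subtractf[of "\<lambda>b. (u2 b - t b) *\<^sub>R b"])
  also have "\<dots> = (\<Sum>b\<in>B - {b0}. (u2 b - t b) *\<^sub>R (b - b0))"
    using fin b0 by (simp add: sum.remove)
  finally have "norm (point B u2 - y) \<le> (\<Sum>b\<in>B - {b0}. norm ((u2 b - t b) *\<^sub>R (b - b0)))"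
    by (simp only: norm_sum)
  also have "\<dots> \<le> (\<Sum>b\<in>B - {b0}. E * norm (b - b0))"
    using w2(4) by (intro sum_mono) (auto intro!: mult_right_mono)
  also have "\<dots> = E * (\<Sum>b\<in>B - {b0}. norm (b - b0))" by (simp add: sum_distrib_left)
  also have "\<dots> < E * (1 + (\<Sum>b\<in>B - {b0}. norm (b - b0)))" using E by simp
  also have "\<dots> = e" using den by (simp add: E_def)
  finally have "point B u2 \<in> U" using y(3) by (auto simp: dist_norm norm_minus_commute)
  then show ?thesis
    using w1 w2 by (intro bexI[of _ "w1 @ w2"] bexI[of _ "point B u2"]) auto
qed

context ifs_attractor
begin

text \<open>A coding is built in stages: from the current interior point, reach the open image of
  the interior under the next word \<open>W i\<close>, then read that word and stay in the interior.
  The \<open>W i\<close> exhaust all words, so the limit sequence is universal.\<close>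

lemma interior_subset_X_uni:
  assumes reach: "\<And>x U. x \<in> interior X \<Longrightarrow> open U \<Longrightarrow> U \<noteq> {} \<Longrightarrow> \<exists>w\<in>lists {0..n}. \<exists>y\<in>U. x = foldr S w y"
  shows "interior X \<subseteq> X_uni {0..n} S X"
proof
  fix x assume x: "x \<in> interior X"
  define W where "W = from_nat_into (lists {0..n})"
  have W: "range W = lists {0..n}"
    unfolding W_def by (rule range_from_nat_into) (auto intro: countable_lists)
  define P where "P = (\<lambda>(_ :: nat) (L, y). L \<in> lists {0..n} \<and> y \<in> interior X \<and> x = foldr S L y)"
  \<comment> \<open>The extra digit 0 lengthens the prefix at every stage, even if \<open>v\<close>
    and \<open>W i\<close> are empty.\<close>
  define Q where "Q = (\<lambda>i (L :: nat list, y :: 'a) (L', y' :: 'a). \<exists>v. L' = L @ v @ 0 # W i)"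
  have "\<exists>f. \<forall>i. P i (f i) \<and> Q i (f i) (f (Suc i))"
  proof (rule dependent_nat_choice)
    show "\<exists>Ly. P 0 Ly" using x by (intro exI[of _ "([], x)"]) (simp add: P_def)
    fix Ly i assume "P i Ly"
    then obtain L y where Ly: "Ly = (L, y)" "L \<in> lists {0..n}" "y \<in> interior X" "x = foldr S L y"
      by (auto simp: P_def split: prod.splits)
    have w: "0 # W i \<in> lists {0..n}" using W by auto
    obtain v z where v: "v \<in> lists {0..n}" "z \<in> foldr S (0 # W i) ` interior X" "y = foldr S v z"
      using reach[OF Ly(3) open_foldr[OF open_interior[of X], of "0 # W i"]] x by (metis empty_iff image_is_empty)
    obtain y' where y': "y' \<in> interior X" "z = foldr S (0 # W i) y'" using v(2) by blast
    show "\<exists>Ly'. P (Suc i) Ly' \<and> Q i Ly Ly'"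
      using Ly v w y' by (intro exI[of _ "(L @ v @ 0 # W i, y')"]) (auto simp: P_def Q_def)
  qed
  then obtain f where f: "\<And>i. P i (f i)" "\<And>i. Q i (f i) (f (Suc i))" by blast
  define L where "L i = fst (f i)" for i
  have L: "L i \<in> lists {0..n}" "\<exists>y\<in>X. x = foldr S (L i) y" for i
    using f(1)[of i] interior_subset[of X] by (auto simp: P_def L_def split: prod.splits)
  have LS: "\<exists>v. L (Suc i) = L i @ v @ 0 # W i" for i
    using f(2)[of i] by (auto simp: Q_def L_def split: prod.splits)
  have len: "i \<le> length (L i)" for i
  proof (induction i)
    case (Suc i)
    then show ?case using LS[of i] by auto
  qed simp
  have pre: "\<exists>v. L (i + k) = L i @ v" for i k
  proof (induction k)
    case (Suc k)
    then show ?case using LS[of "i + k"] by auto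
  qed simp
  have nth: "L j ! m = L i ! m" if "m < length (L i)" "i \<le> j" for i j m
    using pre[of i "j - i"] that by (auto simp: nth_append)
  define a where "a m = L (Suc m) ! m" for m
  have a: "a m = L i ! m" if "m < length (L i)" for i m
    using that len[of "Suc m"] nth[of m i "Suc m"] nth[of m "Suc m" i] by (cases "i \<le> Suc m") (auto simp: a_def)
  have aD: "a m \<in> {0..n}" for m
    using L(1)[of "Suc m"] len[of "Suc m"] nth_mem[of m "L (Suc m)"] by (auto simp: a_def)
  have "coding S a = x"
  proof (rule coding_eqI)
    fix j
    have "map a [0..<j] = take j (L j)" using len[of j] a by (intro nth_equalityI) auto
    moreover obtain y where y: "y \<in> X" "x = foldr S (L j) y" using L(2) by blast
    then have "x = foldr S (take j (L j)) (foldr S (drop j (L j)) y)"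
      by (metis append_take_drop_id foldr_append comp_apply)
    moreover have "foldr S (drop j (L j)) y \<in> X"
      using L(1)[of j] y(1) by (intro foldr_X) (auto dest: in_set_dropD)
    ultimately show "\<exists>y\<in>X. x = foldr S (map a [0..<j]) y" by auto
  qed
  moreover have "universal {0..n} a"
    unfolding universal_def
  proof
    fix w assume "w \<in> lists {0..n}"
    then obtain i where i: "w = W i" using W by blast
    obtain v where v: "L (Suc i) = L i @ v @ 0 # W i" using LS by blast
    show "\<exists>k. \<forall>m<length w. a (k + m) = w ! m"
    proof (intro exI allI impI)
      fix m assume m: "m < length w"
      have "L (Suc i) = (L i @ v @ [0]) @ W i" by (simp add: v)
      then have "L (Suc i) ! (length (L i @ v @ [0]) + m) = W i ! m" by (metis nth_append_length_plus)
      moreover have "length (L i @ v @ [0]) + m < length (L (Suc i))" using m i by (simp add: v)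
      ultimately show "a (length (L i @ v @ [0]) + m) = w ! m" using a i by simp
    qed
  qed
  ultimately show "x \<in> X_uni {0..n} S X"
    using x interior_subset aD by (auto simp: X_uni_def)
qed

end

section \<open>Bounds on \<open>lam\<close> and the two inclusions\<close>

theorem theorem6p3:
  fixes p :: "nat \<Rightarrow> 'a::euclidean_space"
    and n :: nat and lam :: real and X :: "'a set"
    and S :: "nat \<Rightarrow> 'a \<Rightarrow> 'a"
  assumes inj: "inj_on p {0..n}"
    and F_full: "aff_dim (p ` {0..n}) = int DIM('a)"
    and S_def: "\<And>i x. S i x = lam *\<^sub>R x + (1 - lam) *\<^sub>R p i"
    and lam_lo: "2 powr (- 1 / (2 * real DIM('a))) < lam" and lam_hi: "lam < 1"
    and not_pisot: "\<not> pisot (1 / lam ^ (2 * DIM('a)))"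
    and X_compact: "compact X" and X_ne: "X \<noteq> {}"
    and X_attr: "X = (\<Union>i\<in>{0..n}. S i ` X)"
    and cover: "\<forall>x \<in> interior X. \<exists>B \<subseteq> p ` {0..n}. card B = DIM('a) + 1 \<and>
                  aff_dim B = int DIM('a) \<and> x \<in> interior (convex hull B)"
  shows "interior X = X_uni {0..n} S X"
proof -
  let ?d = "DIM('a)"
  have d: "0 < real ?d" by simp
  have lam0: "0 < lam" using lam_lo powr_gt_zero[of 2 "- 1 / (2 * real ?d)"] by linarith
  interpret ifs_attractor p n lam S X
    by unfold_locales (rule S_def lam0 lam_hi X_compact X_ne X_attr)+
  have half: "1 / 2 < lam ^ (2 * ?d)"
  proof -
    have "1 / 2 = (2 :: real) powr (- 1)" by (simp add: powr_minus)
    also have "\<dots> = (2 powr (- 1 / (2 * real ?d))) ^ (2 * ?d)"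
      by (simp add: powr_power)
    also have "\<dots> < lam ^ (2 * ?d)" using lam_lo by (intro power_strict_mono) auto
    finally show ?thesis .
  qed
  have q: "1 < 1 / lam ^ (2 * ?d)" "1 / lam ^ (2 * ?d) < 2"
    using half lam0 lam_hi power_less_one_iff[of lam "2 * ?d"] by (auto simp: field_simps)
  \<comment> \<open>If \<open>lam\<close> were below \<open>d / (d + 1)\<close>, Bernoulli's
    inequality would give \<open>lam ^ (2 * d) < 1 / 4\<close>, against \<open>half\<close>. The
    bound lets \<open>X\<close> contain a full simplex, hence have interior points.\<close>
  have lam_d: "(1 - lam) * real (?d + 1) \<le> 1"
  proof (rule ccontr)
    assume "\<not> ?thesis"
    then have "lam < real ?d / (real ?d + 1)" by (simp add: field_simps)
    then have "lam ^ (2 * ?d) < (real ?d / (real ?d + 1)) ^ (2 * ?d)"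
      using lam0 by (intro power_strict_mono) auto
    moreover have "2 \<le> (1 + 1 / real ?d) ^ ?d"
      using Bernoulli_inequality[of "1 / real ?d" ?d] order_trans[of "- 1" 0 "1 / real ?d"] d by simp
    then have "4 \<le> ((1 + 1 / real ?d) ^ ?d)\<^sup>2" using power_mono[of 2 "(1 + 1 / real ?d) ^ ?d" 2] by simp
    then have "4 \<le> (1 + 1 / real ?d) ^ (2 * ?d)" by (simp add: power_mult[symmetric] mult.commute)
    moreover have "(r / (r + 1)) * (1 + 1 / r) = 1" if "0 < r" for r :: real
    proof -
      have "1 + 1 / r = (r + 1) / r" using that by (simp add: field_simps)
      then show ?thesis using that by simp
    qed
    from this[OF d] have "(real ?d / (real ?d + 1)) ^ (2 * ?d) * (1 + 1 / real ?d) ^ (2 * ?d) = 1"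
      by (simp only: power_mult_distrib[symmetric] power_one)
    ultimately show False
      using half mult_mono[of "1 / 2" "(real ?d / (real ?d + 1)) ^ (2 * ?d)" 4 "(1 + 1 / real ?d) ^ (2 * ?d)"] by linarith
  qed
  obtain B where B: "\<not> affine_dependent B" "B \<subseteq> p ` {0..n}" "affine hull (p ` {0..n}) = affine hull B"
    using affine_basis_exists[of "p ` {0..n}"] by blast
  have finB: "finite B" using B(2) finite_subset by blast
  have cardB: "card B = ?d + 1"
    using aff_dim_affine_independent[OF B(1)] F_full aff_dim_affine_hull[of B] aff_dim_affine_hull[of "p ` {0..n}"] B(3)
    by simp
  have "interior (convex hull B) \<noteq> {}"
    using B(1) cardB finB by (simp add: interior_convex_hull_eq_empty)
  moreover have "convex hull B \<subseteq> X"
    using convex_hull_subset_X[OF finB B(2)] cardB lam_d by fastforce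
  ultimately have ne: "interior X \<noteq> {}" using interior_mono by blast
  show ?thesis
  proof
    show "X_uni {0..n} S X \<subseteq> interior X" by (rule X_uni_subset[OF ne])
    show "interior X \<subseteq> X_uni {0..n} S X"
    proof (rule interior_subset_X_uni)
      fix x :: 'a and U :: "'a set" assume x: "x \<in> interior X" and U: "open U" "U \<noteq> {}"
      obtain B where "B \<subseteq> p ` {0..n}" "card B = ?d + 1" "aff_dim B = int ?d" "x \<in> interior (convex hull B)"
        using cover x by blast
      then show "\<exists>w\<in>lists {0..n}. \<exists>y\<in>U. x = foldr S w y"
        using digit_sums_close[OF q not_pisot] U by (intro reach_open[OF q]) auto
    qed
  qed
qed

end
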